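(* Let $\mathcal X=\{\mathbf x^{(1)},\dots,\mathbf x^{(l)}\}$ with $\mathbf x^{(i)}\in\mathbb R^n$ and $\mathcal Y=\{\mathbf y^{(1)},\dots,\mathbf y^{(l)}\}$ with $\mathbf y^{(i)}\in\mathbb R^m$, $1\le i\le l$, be given, let $\beta>0$ and $s$ be real numbers, let $c_3$ be a real parameter, and let $\psi_*(\mathcal X,\mathcal Y,\beta,s,c_3,t)$ be the function of $t\in[0,1]$ defined in the context. 1) If $0<c_3<1$, then $\frac{d\psi_*(\mathcal X,\mathcal Y,\beta,s,c_3,t)}{dt}<0$ and $\psi_*(\mathcal X,\mathcal Y,\beta,s,c_3,t)$ is decreasing in $t$, and one has the comparison principle $$\lim_{\beta\to\infty}\psi_*(\mathcal X,\mathcal Y,\beta,s,c_3,0)\ \ge\ \lim_{\beta\to\infty}\psi_*(\mathcal X,\mathcal Y,\beta,s,c_3,t)\ \ge\ \lim_{\beta\to\infty}\psi_*(\mathcal X,\mathcal Y,\beta,s,c_3,1).$$ 2) If $c_3>1$ or $c_3<0$, then $\frac{d\psi_*(\mathcal X,\mathcal Y,\beta,s,c_3,t)}{dt}>0$ and $\psi_*(\mathcal X,\mathcal Y,\beta,s,c_3,t)$ is increasing in $t$, and one has the comparison principle $$\lim_{\beta\to\infty}\psi_*(\mathcal X,\mathcal Y,\beta,s,c_3,0)\ \le\ \lim_{\beta\to\infty}\psi_*(\mathcal X,\mathcal Y,\beta,s,c_3,t)\ \le\ \lim_{\beta\to\infty}\psi_*(\mathcal X,\mathcal Y,\beta,s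,c_3,1).$$
   Context: $G\in\mathbb R^{m\times n}$, $u^{(4)}\in\mathbb R$, $\mathbf u^{(2)}\in\mathbb R^m$, $\mathbf h\in\mathbb R^n$ all have i.i.d. standard normal components and are independent of each other; $\mathbb E$ is expectation over all of them. For $t\in[0,1]$, $$H_t^{(i_1,i_2)}=\sqrt t\,(\mathbf y^{(i_2)})^TG\mathbf x^{(i_1)}+\sqrt{1-t}\,\|\mathbf x^{(i_1)}\|_2(\mathbf y^{(i_2)})^T\mathbf u^{(2)}+\sqrt t\,\|\mathbf x^{(i_1)}\|_2\|\mathbf y^{(i_2)}\|_2\,u^{(4)}+\sqrt{1-t}\,\|\mathbf y^{(i_2)}\|_2\,\mathbf h^T\mathbf x^{(i_1)},$$ $$\psi_*(\mathcal X,\mathcal Y,\beta,s,c_3,t)=\mathbb E\left(\sum_{i_1=1}^{l}\left(\sum_{i_2=1}^{l}e^{\beta H_t^{(i_1,i_2)}}\right)^{s}\right)^{c_3}.$$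
   Formalization: Strict sign of the derivative and strict monotonicity are claimed only if s≠0 and neither all x^(i) nor all y^(i) are nonnegative multiples of one vector (else, e.g. s=0 or l=1, ψ_* is constant in t); weak versions hold always. Limits are in the extended reals. *)

theory Defs
  imports "HOL-Probability.Probability"
begin

definition gaussian_components ::
  "('a \<Rightarrow> real^'n^'m) \<Rightarrow> ('a \<Rightarrow> real) \<Rightarrow> ('a \<Rightarrow> real^'m) \<Rightarrow> ('a \<Rightarrow> real^'n)
    \<Rightarrow> ('m \<times> 'n) + unit + 'm + 'n \<Rightarrow> 'a \<Rightarrow> real" where
  "gaussian_components G u4 u2 h k \<omega> =
     (case k of
        Inl (i, j) \<Rightarrow> G \<omega> $ i $ j
      | Inr (Inl _) \<Rightarrow> u4 \<omega>
      | Inr (Inr (Inl i)) \<Rightarrow> u2 \<omega> $ i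
      | Inr (Inr (Inr j)) \<Rightarrow> h \<omega> $ j)"

text \<open>Joint independence of all scalar components says at once that the components of each
  object are i.i.d. and that the four objects are independent of each other.\<close>

definition iid_std_normal ::
  "'a measure \<Rightarrow> ('a \<Rightarrow> real^'n^'m) \<Rightarrow> ('a \<Rightarrow> real) \<Rightarrow> ('a \<Rightarrow> real^'m) \<Rightarrow> ('a \<Rightarrow> real^'n)
    \<Rightarrow> bool" where
  "iid_std_normal M G u4 u2 h \<longleftrightarrow>
     prob_space M \<and>
     prob_space.indep_vars M (\<lambda>_. borel) (gaussian_components G u4 u2 h) UNIV \<and>
     (\<forall>k. distributed M lborel (gaussian_components G u4 u2 h k) std_normal_density)"

text \<open>The arguments are realisations of the random objects and a single pair of vectors
  (one from each family).\<close>

definition H_interp ::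
  "real^'n^'m \<Rightarrow> real \<Rightarrow> real^'m \<Rightarrow> real^'n \<Rightarrow> real \<Rightarrow> real^'n \<Rightarrow> real^'m \<Rightarrow> real" where
  "H_interp G u4 u2 h t x y =
     sqrt t * (y \<bullet> (G *v x))
     + sqrt (1 - t) * norm x * (y \<bullet> u2)
     + sqrt t * norm x * norm y * u4
     + sqrt (1 - t) * norm y * (h \<bullet> x)"

definition psi_star ::
  "'a measure \<Rightarrow> ('a \<Rightarrow> real^'n^'m) \<Rightarrow> ('a \<Rightarrow> real) \<Rightarrow> ('a \<Rightarrow> real^'m) \<Rightarrow> ('a \<Rightarrow> real^'n)
    \<Rightarrow> nat \<Rightarrow> (nat \<Rightarrow> real^'n) \<Rightarrow> (nat \<Rightarrow> real^'m) \<Rightarrow> real \<Rightarrow> real \<Rightarrow> real \<Rightarrow> real \<Rightarrow> real" where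
  "psi_star M G u4 u2 h l x y \<beta> s c3 t =
     (\<integral>\<omega>. (\<Sum>i1 = 1..l.
              (\<Sum>i2 = 1..l. exp (\<beta> * H_interp (G \<omega>) (u4 \<omega>) (u2 \<omega>) (h \<omega>) t (x i1) (y i2))) powr s)
           powr c3 \<partial>M)"

text \<open>The function \<^term>\<open>psi_star M G u4 u2 h l x y \<beta> s c3\<close> is constant in \<open>t\<close> on \<open>[0,1]\<close>
  if \<open>s = 0\<close> (see below), and also if all vectors of one of the two families are
  nonnegative multiples of one vector (in particular if \<open>l = 1\<close>), because then the covariance
  of the process does not depend on \<open>t\<close>:
  its derivative in \<open>t\<close> has the entries
  \<open>(norm x * norm x' - x \<bullet> x') * (norm y * norm y' - y \<bullet> y')\<close>.
  The following predicate excludes exactly these cases; strict monotonicity fails in them.\<close>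

definition nondegenerate ::
  "nat \<Rightarrow> (nat \<Rightarrow> real^'n) \<Rightarrow> (nat \<Rightarrow> real^'m) \<Rightarrow> real \<Rightarrow> bool" where
  "nondegenerate l x y s \<longleftrightarrow>
     s \<noteq> 0 \<and>
     (\<exists>i\<in>{1..l}. \<exists>j\<in>{1..l}. x i \<bullet> x j \<noteq> norm (x i) * norm (x j)) \<and>
     (\<exists>i\<in>{1..l}. \<exists>j\<in>{1..l}. y i \<bullet> y j \<noteq> norm (y i) * norm (y j))"

lemma psi_star_exponent_zero:
  assumes "prob_space M" and "l \<ge> 1"
  shows "psi_star M G u4 u2 h l x y \<beta> 0 c3 t = real l powr c3"
proof -
  interpret prob_space M by fact
  have "(\<Sum>i2 = 1..l. exp (f i2)) > 0" for f :: "nat \<Rightarrow> real"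
    using assms(2) by (intro sum_pos) auto
  then have "(\<Sum>i2 = 1..l. exp (f i2)) powr 0 = 1" for f :: "nat \<Rightarrow> real"
    by (metis less_irrefl powr_zero_eq_one)
  then show ?thesis
    unfolding psi_star_def by (simp add: prob_space)
qed

end

theory Submission
  imports Defs
begin

text \<open>The process is \<open>sqrt t * A + sqrt (1 - t) * B\<close> for independent Gaussian processes \<open>A\<close> and \<open>B\<close>,
  whose covariances differ by
  \<open>(norm x * norm x' - x \<bullet> x') * (norm y * norm y' - y \<bullet> y')\<close>, which is nonnegative and vanishes for
  \<open>x = x'\<close>. Gaussian integration by parts turns the derivative of the expectation into half the sum of
  these differences times expected mixed second derivatives of the functional. Only pairs with distinct first
  vector contribute, and for them the second derivative is \<open>c3 * (c3 - 1)\<close> times a positive quantity.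
  The singular factors \<open>1 / sqrt t\<close> and \<open>1 / sqrt (1 - t)\<close> cancel in the integration by parts, so the
  formula extends to \<open>t = 0\<close> and \<open>t = 1\<close> by continuity.\<close>

subsection \<open>Gaussian integration by parts\<close>

text \<open>No correlated process is ever handled directly. The process is a linear form in finitely
  many independent standard normal coordinates, each scaled by \<open>sqrt t\<close> or
  \<open>sqrt (1 - t)\<close>. Integration by parts is then needed in one coordinate at a time, only
  the pure second derivatives in each coordinate occur, and the covariance difference is a sum over
  coordinates with signs 1 and -1. The main obstacle is domination. The exponents \<open>s\<close>
  and \<open>c\<close> are arbitrary reals, so powers of the sums may be negative and the sums have
  to be controlled from below as well as from above. Growth at most exponential in the sum of the
  absolute coordinates is a class of functions that survives all these operations and is integrable
  for the Gaussian law. Letting beta tend to infinity is a separate matter: the expectations may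
  diverge, so their limits are taken in the extended reals. That they exist follows from a dichotomy
  on the sign of the random growth rate, not from the interpolation; the interpolation only supplies
  the inequalities for each fixed beta.\<close>

abbreviation std_normal :: "real measure" where
  "std_normal \<equiv> density lborel (\<lambda>x. ennreal (std_normal_density x))"

lemma prob_space_std_normal: "prob_space std_normal"
  by (rule prob_space_normal_density) simp

lemma integrable_std_normal_iff:
  fixes f :: "real \<Rightarrow> real"
  assumes "f \<in> borel_measurable borel"
  shows "integrable std_normal f \<longleftrightarrow> integrable lborel (\<lambda>x. std_normal_density x * f x)"
  using assms by (subst integrable_density) auto

text \<open>Completing the square turns \<open>exp (a * x)\<close> times the density into a multiple
  of the normal density with mean \<open>a\<close>. The absolute value is covered by adding the
  cases \<open>a = K\<close> and \<open>a = - K\<close>.\<close>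

lemma integrable_std_normal_exp_abs: "integrable std_normal (\<lambda>x. exp (K * \<bar>x\<bar>))"
proof -
  have *: "integrable std_normal (\<lambda>x. exp (a * x))" for a
  proof -
    have "std_normal_density x * exp (a * x) = exp (a\<^sup>2 / 2) * normal_density a 1 x" for x
      by (simp add: normal_density_def exp_add [symmetric] power2_eq_square field_simps)
    then show ?thesis
      by (subst integrable_std_normal_iff) auto
  qed
  show ?thesis
  proof (rule Bochner_Integration.integrable_bound)
    show "integrable std_normal (\<lambda>x. exp (K * x) + exp (- K * x))"
      by (intro Bochner_Integration.integrable_add *)
    show "AE x in std_normal. norm (exp (K * \<bar>x\<bar>)) \<le> norm (exp (K * x) + exp (- K * x))"
    proof (rule AE_I2)
      show "norm (exp (K * \<bar>x\<bar>)) \<le> norm (exp (K * x) + exp (- K * x))" for x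
        by (cases "x \<ge> 0") (simp_all add: add_nonneg_nonneg abs_of_nonneg)
    qed
  qed auto
qed

text \<open>This makes the boundary terms vanish in the integration by parts. The filter
  \<open>F\<close> is left open so that one argument serves both ends of the real line.\<close>

lemma tendsto_std_normal_density_mult:
  fixes f :: "real \<Rightarrow> real"
  assumes bound: "\<And>x. \<bar>f x\<bar> \<le> C * exp (K * \<bar>x\<bar>)"
    and F: "filterlim (\<lambda>x. \<bar>x\<bar>) at_top F"
  shows "((\<lambda>x. std_normal_density x * f x) \<longlongrightarrow> 0) F"
proof -
  have "C \<ge> 0"
    using bound[of 0] by simp
  have *: "\<bar>std_normal_density x * f x\<bar> \<le> C * exp ((K + 1)\<^sup>2 / 2) * exp (- \<bar>x\<bar>)" for x
  proof -
    have "std_normal_density x \<le> exp (- x\<^sup>2 / 2)"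
      using pi_ge_two by (simp add: normal_density_def field_simps)
    then have "\<bar>std_normal_density x * f x\<bar> \<le> exp (- x\<^sup>2 / 2) * (C * exp (K * \<bar>x\<bar>))"
      unfolding abs_mult using bound[of x] by (intro mult_mono) auto
    also have "\<dots> = C * exp (K * \<bar>x\<bar> - \<bar>x\<bar>\<^sup>2 / 2)"
      by (simp add: exp_add[symmetric] algebra_simps)
    \<comment> \<open>The difference of the two sides is half the square of
      \<open>\<bar>x\<bar> - (K + 1)\<close>. The surplus 1 in \<open>K + 1\<close> is what leaves
      the decaying factor \<open>exp (- \<bar>x\<bar>)\<close>.\<close>
    also have "K * \<bar>x\<bar> - \<bar>x\<bar>\<^sup>2 / 2 \<le> (K + 1)\<^sup>2 / 2 - \<bar>x\<bar>"
      using sum_squares_ge_zero[of "\<bar>x\<bar> - (K + 1)" 0]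
      by (simp add: power2_eq_square algebra_simps)
    finally show ?thesis
      using \<open>C \<ge> 0\<close> by (simp add: mult_left_mono mult.assoc flip: exp_add)
  qed
  have "((\<lambda>x. exp (- \<bar>x\<bar>)) \<longlongrightarrow> 0) F"
    using F by (intro filterlim_compose[OF exp_at_bot]) (simp add: filterlim_uminus_at_top)
  then have "((\<lambda>x. C * exp ((K + 1)\<^sup>2 / 2) * exp (- \<bar>x\<bar>)) \<longlongrightarrow> 0) F"
    by (rule tendsto_mult_right_zero)
  then show ?thesis
    by (rule Lim_null_comparison[rotated]) (use * in auto)
qed

lemma integrable_std_normal_exp_bounded:
  fixes f :: "real \<Rightarrow> real"
  assumes "f \<in> borel_measurable borel" and "\<And>x. \<bar>f x\<bar> \<le> C * exp (K * \<bar>x\<bar>)"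
  shows "integrable std_normal f"
proof (rule Bochner_Integration.integrable_bound)
  show "integrable std_normal (\<lambda>x. C * exp (K * \<bar>x\<bar>))"
    using integrable_std_normal_exp_abs by simp
  show "AE x in std_normal. norm (f x) \<le> norm (C * exp (K * \<bar>x\<bar>))"
    using assms(2) by (intro AE_I2) (metis abs_ge_self order_trans real_norm_def)
qed (use assms in auto)

text \<open>Since the density has derivative \<open>- x\<close> times itself, the product of density
  and \<open>f\<close> is an antiderivative of density times \<open>f' x - x * f x\<close>. The
  fundamental theorem on the whole line, with vanishing boundary terms, gives the claim.\<close>

lemma stein_identity:
  fixes f f' :: "real \<Rightarrow> real"
  assumes deriv: "\<And>x. (f has_real_derivative f' x) (at x)"
    and cont: "continuous_on UNIV f'"
    and bound: "\<And>x. \<bar>f x\<bar> \<le> C * exp (K * \<bar>x\<bar>)" and bound': "\<And>x. \<bar>f' x\<bar> \<le> C' * exp (K' * \<bar>x\<bar>)"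
  shows "(\<integral>x. x * f x \<partial>std_normal) = (\<integral>x. f' x \<partial>std_normal)"
proof -
  let ?\<phi> = "std_normal_density"
  have contf: "continuous_on UNIV f"
    using deriv by (auto intro!: continuous_at_imp_continuous_on DERIV_isCont)
  have [measurable]: "f \<in> borel_measurable borel" "f' \<in> borel_measurable borel"
    using cont contf by (auto intro: borel_measurable_continuous_onI)
  have "C \<ge> 0"
    using bound[of 0] by simp
  \<comment> \<open>The extra factor \<open>x\<close> is absorbed by raising the exponential rate by
    1.\<close>
  have xf: "\<bar>x * f x\<bar> \<le> C * exp ((K + 1) * \<bar>x\<bar>)" for x
  proof -
    have "\<bar>x * f x\<bar> \<le> exp \<bar>x\<bar> * (C * exp (K * \<bar>x\<bar>))"
      unfolding abs_mult using bound[of x] exp_ge_add_one_self[of "\<bar>x\<bar>"] by (intro mult_mono) linarith+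
    then show ?thesis by (simp add: exp_add[symmetric] algebra_simps)
  qed
  have int1: "integrable std_normal (\<lambda>x. x * f x)"
    by (rule integrable_std_normal_exp_bounded[OF _ xf]) simp
  have int2: "integrable std_normal f'"
    by (rule integrable_std_normal_exp_bounded[OF _ bound']) simp
  have int: "integrable lborel (\<lambda>x. ?\<phi> x * (f' x - x * f x))"
    using Bochner_Integration.integrable_diff[OF int2 int1] by (simp add: integrable_std_normal_iff)
  have "(\<integral>x. ?\<phi> x * (f' x - x * f x) \<partial>lborel)
      = (LBINT x=-\<infinity>..\<infinity>. ?\<phi> x * (f' x - x * f x))"
    by (simp add: interval_lebesgue_integral_def set_lebesgue_integral_def)
  also have "\<dots> = 0 - 0"
  proof (rule interval_integral_FTC_integrable[where F = "\<lambda>x. ?\<phi> x * f x"])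
    show "((\<lambda>x. ?\<phi> x * f x) has_vector_derivative ?\<phi> x * (f' x - x * f x)) (at x)" for x
    proof -
      define c where "c = 1 / sqrt (2 * pi)"
      have \<phi>: "?\<phi> = (\<lambda>x. c * exp (- x\<^sup>2 / 2))"
        by (simp add: fun_eq_iff c_def std_normal_density_def)
      show ?thesis
        unfolding has_real_derivative_iff_has_vector_derivative[symmetric] \<phi>
        by (auto intro!: derivative_eq_intros deriv simp: algebra_simps)
    qed
    show "isCont (\<lambda>x. ?\<phi> x * (f' x - x * f x)) x" for x
      using cont contf unfolding std_normal_density_def
      by (auto intro!: continuous_intros simp: continuous_on_eq_continuous_at)
    show "set_integrable lborel (einterval (-\<infinity>) \<infinity>) (\<lambda>x. ?\<phi> x * (f' x - x * f x))"
      using int by (simp add: set_integrable_def)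
    show "(((\<lambda>x. ?\<phi> x * f x) \<circ> real_of_ereal) \<longlongrightarrow> 0) (at_right (- \<infinity>))"
      unfolding ereal_tendsto_simps
    proof (rule tendsto_std_normal_density_mult[OF bound])
      have "\<forall>\<^sub>F x in at_bot. Z \<le> \<bar>x\<bar>" for Z :: real
        using eventually_le_at_bot[of "- Z"] by eventually_elim linarith
      then show "filterlim (\<lambda>x::real. \<bar>x\<bar>) at_top at_bot"
        by (simp add: filterlim_at_top)
    qed
    show "(((\<lambda>x. ?\<phi> x * f x) \<circ> real_of_ereal) \<longlongrightarrow> 0) (at_left \<infinity>)"
      unfolding ereal_tendsto_simps
      by (rule tendsto_std_normal_density_mult[OF bound filterlim_abs_real])
  qed auto
  finally have "(\<integral>x. f' x - x * f x \<partial>std_normal) = 0"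
    by (subst integral_density) auto
  then show ?thesis
    using int1 int2 by simp
qed

section \<open>Finite families of standard normals and functions of exponential growth\<close>

abbreviation std_normal_family :: "('k \<Rightarrow> real) measure" where
  "std_normal_family \<equiv> PiM UNIV (\<lambda>_. std_normal)"

lemma sets_std_normal_family [measurable_cong]:
  "sets std_normal_family = sets (PiM UNIV (\<lambda>_. borel))"
  by (intro sets_PiM_cong) auto

lemma prob_space_std_normal_family: "prob_space (std_normal_family :: ('k \<Rightarrow> real) measure)"
  by (intro prob_space_PiM prob_space_std_normal)

lemma borel_measurable_std_normal_family [simp]:
  "borel_measurable std_normal_family = borel_measurable (PiM UNIV (\<lambda>_. borel))"
  by (rule measurable_cong_sets) (simp_all add: sets_std_normal_family)

lemma product_sigma_finite_std_normal: "product_sigma_finite (\<lambda>_. std_normal)"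
  using prob_space_std_normal
  by (simp add: product_sigma_finite_def prob_space_imp_sigma_finite)

lemma measurable_scale [measurable]:
  "(\<lambda>w k. c k * w k) \<in> PiM UNIV (\<lambda>_. borel) \<rightarrow>\<^sub>M PiM UNIV (\<lambda>_. borel :: real measure)"
  by (rule measurable_PiM_single') (auto simp: space_PiM)

text \<open>The sum of absolute values is chosen as the norm because its exponential factors over
  the coordinates, which reduces integrability to dimension one. Nonnegative constants make the
  bound monotone in the norm.\<close>

definition exp_bounded :: "(('k::finite \<Rightarrow> real) \<Rightarrow> real) \<Rightarrow> bool" where
  "exp_bounded f \<longleftrightarrow> (\<exists>C\<ge>0. \<exists>K\<ge>0. \<forall>w. \<bar>f w\<bar> \<le> C * exp (K * (\<Sum>k\<in>UNIV. \<bar>w k\<bar>)))"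

text \<open>The signs of the constants come for free: the value at the origin forces
  \<open>C\<close> to be nonnegative, and \<open>K\<close> may be replaced by its absolute
  value.\<close>

lemma exp_boundedI:
  assumes "\<And>w. \<bar>f w\<bar> \<le> C * exp (K * (\<Sum>k\<in>UNIV. \<bar>w k\<bar>))"
  shows "exp_bounded f"
proof -
  have "C \<ge> 0"
    using assms[of "\<lambda>_. 0"] by simp
  moreover have "\<bar>f w\<bar> \<le> C * exp (\<bar>K\<bar> * (\<Sum>k\<in>UNIV. \<bar>w k\<bar>))" for w
    by (rule order_trans[OF assms])
      (use \<open>C \<ge> 0\<close> in \<open>auto intro!: mult_left_mono mult_right_mono sum_nonneg\<close>)
  ultimately show ?thesis
    unfolding exp_bounded_def by (metis abs_ge_zero)
qed

lemma exp_boundedE: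
  assumes "exp_bounded f"
  obtains C K where "C \<ge> 0" "K \<ge> 0" "\<And>w. \<bar>f w\<bar> \<le> C * exp (K * (\<Sum>k\<in>UNIV. \<bar>w k\<bar>))"
  using assms unfolding exp_bounded_def by blast

lemma exp_bounded_mono:
  assumes "exp_bounded g" "\<And>w. \<bar>f w\<bar> \<le> \<bar>g w\<bar>"
  shows "exp_bounded f"
  using assms unfolding exp_bounded_def by (meson order_trans)

lemma exp_bounded_const: "exp_bounded (\<lambda>_. c)"
  by (rule exp_boundedI[of _ "\<bar>c\<bar>" 0]) simp

lemma exp_bounded_coordinate: "exp_bounded (\<lambda>w. w k)"
proof (rule exp_boundedI[of _ 1 1])
  fix w :: "'a \<Rightarrow> real"
  have "\<bar>w k\<bar> \<le> (\<Sum>k\<in>UNIV. \<bar>w k\<bar>)"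
    by (intro member_le_sum) auto
  also have "\<dots> \<le> exp \<dots>"
    using exp_ge_add_one_self[of "\<Sum>k\<in>UNIV. \<bar>w k\<bar>"] by linarith
  finally show "\<bar>w k\<bar> \<le> 1 * exp (1 * (\<Sum>k\<in>UNIV. \<bar>w k\<bar>))"
    by simp
qed

lemma exp_bounded_add:
  assumes "exp_bounded f" "exp_bounded g"
  shows "exp_bounded (\<lambda>w. f w + g w)"
proof -
  obtain C K C' K' where *: "C \<ge> 0" "K \<ge> 0" "C' \<ge> 0" "K' \<ge> 0"
    "\<And>w. \<bar>f w\<bar> \<le> C * exp (K * (\<Sum>k\<in>UNIV. \<bar>w k\<bar>))"
    "\<And>w. \<bar>g w\<bar> \<le> C' * exp (K' * (\<Sum>k\<in>UNIV. \<bar>w k\<bar>))"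
    using assms by (auto elim!: exp_boundedE)
  show ?thesis
  proof (rule exp_boundedI)
    fix w :: "'a \<Rightarrow> real"
    have N: "0 \<le> (\<Sum>k\<in>UNIV. \<bar>w k\<bar>)" by (intro sum_nonneg) auto
    have "\<bar>f w + g w\<bar> \<le> C * exp (K * (\<Sum>k\<in>UNIV. \<bar>w k\<bar>)) + C' * exp (K' * (\<Sum>k\<in>UNIV. \<bar>w k\<bar>))"
      using *(5,6)[of w] by linarith
    also have "\<dots> \<le> C * exp ((K + K') * (\<Sum>k\<in>UNIV. \<bar>w k\<bar>)) + C' * exp ((K + K') * (\<Sum>k\<in>UNIV. \<bar>w k\<bar>))"
      using * N by (intro add_mono mult_left_mono) (auto intro!: mult_right_mono)
    finally show "\<bar>f w + g w\<bar> \<le> (C + C') * exp ((K + K') * (\<Sum>k\<in>UNIV. \<bar>w k\<bar>))"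
      by (simp add: algebra_simps)
  qed
qed

lemma exp_bounded_mult:
  assumes "exp_bounded f" "exp_bounded g"
  shows "exp_bounded (\<lambda>w. f w * g w)"
proof -
  obtain C K C' K' where *: "C \<ge> 0" "K \<ge> 0" "C' \<ge> 0" "K' \<ge> 0"
    "\<And>w. \<bar>f w\<bar> \<le> C * exp (K * (\<Sum>k\<in>UNIV. \<bar>w k\<bar>))"
    "\<And>w. \<bar>g w\<bar> \<le> C' * exp (K' * (\<Sum>k\<in>UNIV. \<bar>w k\<bar>))"
    using assms by (auto elim!: exp_boundedE)
  show ?thesis
  proof (rule exp_boundedI)
    fix w :: "'a \<Rightarrow> real"
    have "\<bar>f w * g w\<bar> \<le> (C * exp (K * (\<Sum>k\<in>UNIV. \<bar>w k\<bar>))) * (C' * exp (K' * (\<Sum>k\<in>UNIV. \<bar>w k\<bar>)))"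
      unfolding abs_mult using * by (intro mult_mono) auto
    then show "\<bar>f w * g w\<bar> \<le> (C * C') * exp ((K + K') * (\<Sum>k\<in>UNIV. \<bar>w k\<bar>))"
      by (simp add: algebra_simps exp_add)
  qed
qed

lemma exp_bounded_sum:
  assumes "\<And>i. i \<in> I \<Longrightarrow> exp_bounded (f i)"
  shows "exp_bounded (\<lambda>w. \<Sum>i\<in>I. f i w)"
  using assms
  by (induction I rule: infinite_finite_induct) (auto intro: exp_bounded_const exp_bounded_add)

lemma exp_bounded_power2: "exp_bounded f \<Longrightarrow> exp_bounded (\<lambda>w. (f w)\<^sup>2)"
  unfolding power2_eq_square by (rule exp_bounded_mult)

lemma exp_bounded_exp_linear: "exp_bounded (\<lambda>w. exp (\<Sum>k\<in>UNIV. v k * w k))"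
proof (rule exp_boundedI[of _ 1 "\<Sum>k\<in>UNIV. \<bar>v k\<bar>"])
  fix w :: "'a \<Rightarrow> real"
  have "(\<Sum>k\<in>UNIV. v k * w k) \<le> (\<Sum>k\<in>UNIV. \<bar>v k\<bar> * (\<Sum>k\<in>UNIV. \<bar>w k\<bar>))"
  proof (rule sum_mono)
    fix k
    have "v k * w k \<le> \<bar>v k\<bar> * \<bar>w k\<bar>"
      by (metis abs_ge_self abs_mult)
    also have "\<bar>w k\<bar> \<le> (\<Sum>k\<in>UNIV. \<bar>w k\<bar>)"
      by (intro member_le_sum) auto
    finally show "v k * w k \<le> \<bar>v k\<bar> * (\<Sum>k\<in>UNIV. \<bar>w k\<bar>)"
      by (simp add: mult_left_mono)
  qed
  then show "\<bar>exp (\<Sum>k\<in>UNIV. v k * w k)\<bar> \<le> 1 * exp ((\<Sum>k\<in>UNIV. \<bar>v k\<bar>) * (\<Sum>k\<in>UNIV. \<bar>w k\<bar>))"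
    by (simp add: sum_distrib_right)
qed

text \<open>A negative power of \<open>f\<close> is a positive power of its inverse; hence the
  growth condition on both \<open>f\<close> and \<open>inverse (f w)\<close>.\<close>

lemma exp_bounded_powr:
  assumes "exp_bounded f" "exp_bounded (\<lambda>w. inverse (f w))" "\<And>w. f w > 0"
  shows "exp_bounded (\<lambda>w. f w powr a)"
proof -
  have *: "exp_bounded (\<lambda>w. f w powr a)"
    if f: "exp_bounded f" "\<And>w. f w > 0" and a: "a \<ge> 0" for f :: "('a \<Rightarrow> real) \<Rightarrow> real" and a
  proof -
    obtain C K where *: "C \<ge> 0" "K \<ge> 0" "\<And>w. \<bar>f w\<bar> \<le> C * exp (K * (\<Sum>k\<in>UNIV. \<bar>w k\<bar>))"
      using f by (auto elim!: exp_boundedE)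
    have "\<bar>f w powr a\<bar> \<le> C powr a * exp ((a * K) * (\<Sum>k\<in>UNIV. \<bar>w k\<bar>))" for w
    proof -
      have "f w powr a \<le> (C * exp (K * (\<Sum>k\<in>UNIV. \<bar>w k\<bar>))) powr a"
        using *(3)[of w] f(2)[of w] a by (intro powr_mono2) auto
      also have "\<dots> = C powr a * exp ((a * K) * (\<Sum>k\<in>UNIV. \<bar>w k\<bar>))"
        using * by (simp add: powr_mult) (simp add: powr_def algebra_simps)
      finally show ?thesis by simp
    qed
    then show ?thesis by (rule exp_boundedI)
  qed
  show ?thesis
  proof (cases "a \<ge> 0")
    case False
    have "exp_bounded (\<lambda>w. inverse (f w) powr (- a))"
      using assms False by (intro *) auto
    moreover have "inverse (f w) powr (- a) = f w powr a" for w
      using assms(3)[of w] by (simp add: powr_minus_divide powr_divide inverse_eq_divide)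
    ultimately show ?thesis by simp
  qed (use * assms in auto)
qed

text \<open>Shrinking coordinates does not increase the norm, so the constants of \<open>f\<close>
  continue to work for the scaled function.\<close>

lemma exp_bounded_scale:
  assumes "exp_bounded f" "\<And>k. \<bar>c k\<bar> \<le> 1"
  shows "exp_bounded (\<lambda>w. f (\<lambda>k. c k * w k))"
proof -
  obtain C K where *: "C \<ge> 0" "K \<ge> 0" "\<And>w. \<bar>f w\<bar> \<le> C * exp (K * (\<Sum>k\<in>UNIV. \<bar>w k\<bar>))"
    using assms by (auto elim!: exp_boundedE)
  show ?thesis
  proof (rule exp_boundedI)
    fix w :: "'a \<Rightarrow> real"
    have "(\<Sum>k\<in>UNIV. \<bar>c k * w k\<bar>) \<le> (\<Sum>k\<in>UNIV. \<bar>w k\<bar>)"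
      using assms(2) by (intro sum_mono) (simp add: abs_mult mult_left_le_one_le)
    then show "\<bar>f (\<lambda>k. c k * w k)\<bar> \<le> C * exp (K * (\<Sum>k\<in>UNIV. \<bar>w k\<bar>))"
      using * by (intro order_trans[OF *(3)] mult_left_mono) (auto intro: mult_left_mono)
  qed
qed

lemma integrable_exp_norm_std_normal_family:
  "integrable (std_normal_family :: ('k::finite \<Rightarrow> real) measure) (\<lambda>w. exp (K * (\<Sum>k\<in>UNIV. \<bar>w k\<bar>)))"
proof -
  interpret product_sigma_finite "\<lambda>_::'k. std_normal"
    by (rule product_sigma_finite_std_normal)
  have "integrable std_normal_family (\<lambda>w :: 'k \<Rightarrow> real. \<Prod>k\<in>UNIV. exp (K * \<bar>w k\<bar>))"
    by (intro product_integrable_prod integrable_std_normal_exp_abs) auto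
  then show ?thesis
    by (simp add: exp_sum sum_distrib_left)
qed

lemma integrable_std_normal_family:
  fixes f :: "('k::finite \<Rightarrow> real) \<Rightarrow> real"
  assumes "exp_bounded f" "f \<in> borel_measurable (PiM UNIV (\<lambda>_. borel))"
  shows "integrable std_normal_family f"
proof -
  obtain C K where *: "C \<ge> 0" "K \<ge> 0" "\<And>w. \<bar>f w\<bar> \<le> C * exp (K * (\<Sum>k\<in>UNIV. \<bar>w k\<bar>))"
    using assms by (auto elim!: exp_boundedE)
  show ?thesis
  proof (rule Bochner_Integration.integrable_bound)
    show "integrable std_normal_family (\<lambda>w::'k\<Rightarrow>real. C * exp (K * (\<Sum>k\<in>UNIV. \<bar>w k\<bar>)))"
      using integrable_exp_norm_std_normal_family by (intro integrable_mult_right)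
    show "AE w in std_normal_family. norm (f w) \<le> norm (C * exp (K * (\<Sum>k\<in>UNIV. \<bar>w k\<bar>)))"
      using *(1,3) by (intro AE_I2) simp
  qed (use assms in simp)
qed

text \<open>By Fubini the coordinate \<open>k\<close> is integrated first, with the others frozen,
  and the one-dimensional identity applies on that line. The scaling by \<open>c\<close> is inside
  the function, so the chain rule produces the factor \<open>c k\<close>.\<close>

lemma stein_identity_family:
  fixes f f' :: "('k::finite \<Rightarrow> real) \<Rightarrow> real" and c :: "'k \<Rightarrow> real"
  assumes deriv: "\<And>w r. ((\<lambda>r. f (w(k := r))) has_real_derivative f' (w(k := r))) (at r)"
    and cont: "\<And>w. continuous_on UNIV (\<lambda>r. f' (w(k := r)))"
    and bound: "exp_bounded f" "exp_bounded f'"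
    and meas [measurable]: "f \<in> borel_measurable (PiM UNIV (\<lambda>_. borel))"
      "f' \<in> borel_measurable (PiM UNIV (\<lambda>_. borel))"
    and c: "\<And>k. \<bar>c k\<bar> \<le> 1"
  shows "(\<integral>w. w k * f (\<lambda>j. c j * w j) \<partial>std_normal_family)
    = c k * (\<integral>w. f' (\<lambda>j. c j * w j) \<partial>std_normal_family)"
proof -
  interpret product_sigma_finite "\<lambda>_::'k. std_normal"
    by (rule product_sigma_finite_std_normal)
  define g where "g = (\<lambda>w. f (\<lambda>j. c j * w j))"
  define g' where "g' = (\<lambda>w. c k * f' (\<lambda>j. c j * w j))"
  have [measurable]: "g \<in> borel_measurable (PiM UNIV (\<lambda>_. borel))"
    "g' \<in> borel_measurable (PiM UNIV (\<lambda>_. borel))"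
    unfolding g_def g'_def by measurable
  have eg: "exp_bounded g" and eg': "exp_bounded g'"
    unfolding g_def g'_def
    by (intro exp_bounded_mult exp_bounded_const exp_bounded_scale bound c)+
  have upd: "(\<lambda>j. c j * (w(k := r)) j) = (\<lambda>j. c j * w j)(k := c k * r)" for w r
    by auto
  have dg: "((\<lambda>r. g (w(k := r))) has_real_derivative g' (w(k := r))) (at r)" for w r
    unfolding g_def g'_def upd mult.commute[of "c k" "f' _"]
    by (rule DERIV_chain2[OF deriv]) (auto intro!: derivative_eq_intros)
  have cg: "continuous_on UNIV (\<lambda>r. g' (w(k := r)))" for w
    unfolding g'_def upd
    by (intro continuous_on_mult continuous_on_const continuous_on_compose2[OF cont] continuous_on_id) auto
  have insert: "insert k (UNIV - {k}) = UNIV"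
    by auto
  have line: "\<exists>C K. \<forall>r. \<bar>f (w(k := r))\<bar> \<le> C * exp (K * \<bar>r\<bar>)"
    if f: "exp_bounded f" for f and w :: "'k \<Rightarrow> real"
  proof -
    obtain C K where *: "C \<ge> 0" "K \<ge> 0" "\<And>w. \<bar>f w\<bar> \<le> C * exp (K * (\<Sum>k\<in>UNIV. \<bar>w k\<bar>))"
      using f by (auto elim!: exp_boundedE)
    have "(\<Sum>j\<in>UNIV. \<bar>(w(k := r)) j\<bar>) = \<bar>r\<bar> + (\<Sum>j\<in>UNIV-{k}. \<bar>w j\<bar>)" for r
      by (subst sum.remove[of _ k]) auto
    then have "\<bar>f (w(k := r))\<bar> \<le> (C * exp (K * (\<Sum>j\<in>UNIV-{k}. \<bar>w j\<bar>))) * exp (K * \<bar>r\<bar>)" for r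
      using *(3)[of "w(k := r)"] by (simp add: algebra_simps exp_add)
    then show ?thesis by blast
  qed
  have "(\<integral>w. w k * g w \<partial>PiM (insert k (UNIV - {k})) (\<lambda>_. std_normal))
      = (\<integral>w. (\<integral>r. r * g (w(k := r)) \<partial>std_normal) \<partial>PiM (UNIV - {k}) (\<lambda>_. std_normal))"
    by (subst product_integral_insert)
      (auto simp: insert intro!: integrable_std_normal_family exp_bounded_mult exp_bounded_coordinate eg)
  also have "\<dots> = (\<integral>w. (\<integral>r. g' (w(k := r)) \<partial>std_normal) \<partial>PiM (UNIV - {k}) (\<lambda>_. std_normal))"
  proof (rule Bochner_Integration.integral_cong[OF refl])
    fix w :: "'k \<Rightarrow> real"
    obtain C K C' K' where *: "\<And>r. \<bar>g (w(k := r))\<bar> \<le> C * exp (K * \<bar>r\<bar>)"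
      "\<And>r. \<bar>g' (w(k := r))\<bar> \<le> C' * exp (K' * \<bar>r\<bar>)"
      using line[OF eg, of w] line[OF eg', of w] by blast
    show "(\<integral>r. r * g (w(k := r)) \<partial>std_normal) = (\<integral>r. g' (w(k := r)) \<partial>std_normal)"
      by (rule stein_identity[OF dg cg *])
  qed
  also have "\<dots> = (\<integral>w. g' w \<partial>PiM (insert k (UNIV - {k})) (\<lambda>_. std_normal))"
    by (subst product_integral_insert)
      (auto simp: insert intro!: integrable_std_normal_family eg')
  finally show ?thesis
    unfolding insert g_def g'_def by simp
qed

subsection \<open>Gaussian interpolation\<close>

lemma continuous_on_integral:
  fixes f :: "'b::first_countable_topology \<Rightarrow> 'a \<Rightarrow> real"
  assumes cont: "\<And>\<omega>. \<omega> \<in> space M \<Longrightarrow> continuous_on S (\<lambda>u. f u \<omega>)"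
    and bound: "\<And>u \<omega>. u \<in> S \<Longrightarrow> \<omega> \<in> space M \<Longrightarrow> \<bar>f u \<omega>\<bar> \<le> g \<omega>"
    and g: "integrable M g"
    and meas: "\<And>u. u \<in> S \<Longrightarrow> f u \<in> borel_measurable M"
  shows "continuous_on S (\<lambda>u. \<integral>\<omega>. f u \<omega> \<partial>M)"
  unfolding continuous_on_def
proof
  fix t assume t: "t \<in> S"
  show "((\<lambda>u. \<integral>\<omega>. f u \<omega> \<partial>M) \<longlongrightarrow> (\<integral>\<omega>. f t \<omega> \<partial>M)) (at t within S)"
    unfolding tendsto_at_iff_sequentially comp_def
  proof (intro allI impI)
    fix X assume X: "\<forall>i. X i \<in> S - {t}" "X \<longlonglongrightarrow> t"
    show "(\<lambda>i. \<integral>\<omega>. f (X i) \<omega> \<partial>M) \<longlonglongrightarrow> (\<integral>\<omega>. f t \<omega> \<partial>M)"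
    proof (rule integral_dominated_convergence[where w = g])
      show "AE \<omega> in M. (\<lambda>i. f (X i) \<omega>) \<longlonglongrightarrow> f t \<omega>"
      proof (rule AE_I2)
        fix \<omega> assume "\<omega> \<in> space M"
        then have "((\<lambda>u. f u \<omega>) \<longlongrightarrow> f t \<omega>) (at t within S)"
          using cont t by (simp add: continuous_on_def)
        then show "(\<lambda>i. f (X i) \<omega>) \<longlonglongrightarrow> f t \<omega>"
          using X unfolding tendsto_at_iff_sequentially comp_def by blast
      qed
      show "AE \<omega> in M. norm (f (X i) \<omega>) \<le> g \<omega>" for i
        using X bound by (intro AE_I2) auto
    qed (use X t g meas in auto)
  qed
qed

text \<open>By the mean value inequality the bound \<open>g\<close> on the derivatives also bounds
  every difference quotient, so dominated convergence applies. Domination is asked for only on an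
  interval around \<open>t\<close>, which allows derivatives that blow up elsewhere.\<close>

lemma has_real_derivative_integral:
  fixes f :: "real \<Rightarrow> 'a \<Rightarrow> real"
  assumes ab: "a < t" "t < b"
    and deriv: "\<And>u \<omega>. u \<in> {a<..<b} \<Longrightarrow> \<omega> \<in> space M \<Longrightarrow>
      ((\<lambda>u. f u \<omega>) has_real_derivative f' u \<omega>) (at u)"
    and bound: "\<And>u \<omega>. u \<in> {a<..<b} \<Longrightarrow> \<omega> \<in> space M \<Longrightarrow> \<bar>f' u \<omega>\<bar> \<le> g \<omega>"
    and g: "integrable M g"
    and int: "\<And>u. u \<in> {a<..<b} \<Longrightarrow> integrable M (f u)"
    and meas: "f' t \<in> borel_measurable M"
  shows "((\<lambda>u. \<integral>\<omega>. f u \<omega> \<partial>M) has_real_derivative (\<integral>\<omega>. f' t \<omega> \<partial>M)) (at t)"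
proof -
  let ?S = "{a<..<b}"
  have S: "t \<in> ?S" "open ?S"
    using ab by auto
  have "((\<lambda>u. ((\<integral>\<omega>. f u \<omega> \<partial>M) - (\<integral>\<omega>. f t \<omega> \<partial>M)) / (u - t)) \<longlongrightarrow> (\<integral>\<omega>. f' t \<omega> \<partial>M)) (at t within ?S)"
    unfolding tendsto_at_iff_sequentially comp_def
  proof (intro allI impI)
    fix X assume X: "\<forall>i. X i \<in> ?S - {t}" "X \<longlonglongrightarrow> t"
    have "(\<lambda>i. \<integral>\<omega>. (f (X i) \<omega> - f t \<omega>) / (X i - t) \<partial>M) \<longlonglongrightarrow> (\<integral>\<omega>. f' t \<omega> \<partial>M)"
    proof (rule integral_dominated_convergence[where w = g])
      show "AE \<omega> in M. (\<lambda>i. (f (X i) \<omega> - f t \<omega>) / (X i - t)) \<longlonglongrightarrow> f' t \<omega>"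
      proof (rule AE_I2)
        fix \<omega> assume "\<omega> \<in> space M"
        then have "((\<lambda>u. f u \<omega>) has_real_derivative f' t \<omega>) (at t within ?S)"
          using has_field_derivative_at_within[OF deriv[OF S(1)]] by simp
        then show "(\<lambda>i. (f (X i) \<omega> - f t \<omega>) / (X i - t)) \<longlonglongrightarrow> f' t \<omega>"
          using X by (simp add: has_field_derivative_iff tendsto_at_iff_sequentially comp_def)
      qed
      show "AE \<omega> in M. norm ((f (X i) \<omega> - f t \<omega>) / (X i - t)) \<le> g \<omega>" for i
      proof (rule AE_I2)
        fix \<omega> assume \<omega>: "\<omega> \<in> space M"
        have Xi: "X i \<in> ?S" "X i \<noteq> t"
          using X by auto
        have "norm (f (X i) \<omega> - f t \<omega>) \<le> g \<omega> * norm (X i - t)"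
        proof (rule field_differentiable_bound[where S = ?S and f' = "\<lambda>u. f' u \<omega>"])
          show "((\<lambda>u. f u \<omega>) has_field_derivative f' u \<omega>) (at u within ?S)" if "u \<in> ?S" for u
            by (rule has_field_derivative_at_within[OF deriv[OF that \<omega>]])
          show "norm (f' u \<omega>) \<le> g \<omega>" if "u \<in> ?S" for u
            using bound[OF that \<omega>] by simp
        qed (use S Xi in auto)
        then show "norm ((f (X i) \<omega> - f t \<omega>) / (X i - t)) \<le> g \<omega>"
          using Xi(2) by (simp add: norm_divide pos_divide_le_eq del: real_norm_def)
      qed
      show "(\<lambda>\<omega>. (f (X i) \<omega> - f t \<omega>) / (X i - t)) \<in> borel_measurable M" for i
      proof -
        have [measurable]: "f (X i) \<in> borel_measurable M" "f t \<in> borel_measurable M"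
          using X S by (intro borel_measurable_integrable int; blast)+
        show ?thesis by measurable
      qed
    qed (use g meas in auto)
    also have "(\<lambda>i. \<integral>\<omega>. (f (X i) \<omega> - f t \<omega>) / (X i - t) \<partial>M)
        = (\<lambda>i. ((\<integral>\<omega>. f (X i) \<omega> \<partial>M) - (\<integral>\<omega>. f t \<omega> \<partial>M)) / (X i - t))"
    proof
      fix i
      have "integrable M (f (X i))" "integrable M (f t)"
        using X S by (auto intro: int)
      then show "(\<integral>\<omega>. (f (X i) \<omega> - f t \<omega>) / (X i - t) \<partial>M)
          = ((\<integral>\<omega>. f (X i) \<omega> \<partial>M) - (\<integral>\<omega>. f t \<omega> \<partial>M)) / (X i - t)"
        by simp
    qed
    finally show "(\<lambda>i. ((\<integral>\<omega>. f (X i) \<omega> \<partial>M) - (\<integral>\<omega>. f t \<omega> \<partial>M)) / (X i - t)) \<longlonglongrightarrow> (\<integral>\<omega>. f' t \<omega> \<partial>M)" .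
  qed
  then show ?thesis
    unfolding at_within_open[OF S] has_field_derivative_iff .
qed

text \<open>On the closed interval \<open>f\<close> equals \<open>f a\<close> plus the integral of
  the continuous function \<open>f'\<close>, and such an integral is differentiable at the end
  points too. This is how a formula known only for 0 < t < 1 reaches \<open>t = 0\<close> and
  \<open>t = 1\<close>, where the square roots cannot be differentiated.\<close>

lemma has_real_derivative_closed_interval:
  fixes f f' :: "real \<Rightarrow> real"
  assumes cont: "continuous_on {a..b} f" and cont': "continuous_on {a..b} f'"
    and deriv: "\<And>u. u \<in> {a<..<b} \<Longrightarrow> (f has_real_derivative f' u) (at u)"
    and t: "t \<in> {a..b}"
  shows "(f has_real_derivative f' t) (at t within {a..b})"
proof -
  have eq: "f a + integral {a..u} f' = f u" if "u \<in> {a..b}" for u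
  proof -
    have "(f' has_integral (f u - f a)) {a..u}"
    proof (rule fundamental_theorem_of_calculus_interior)
      show "continuous_on {a..u} f"
        by (rule continuous_on_subset[OF cont]) (use that in auto)
      show "(f has_vector_derivative f' v) (at v)" if "v \<in> {a<..<u}" for v
        unfolding has_real_derivative_iff_has_vector_derivative[symmetric]
        by (rule deriv) (use that \<open>u \<in> {a..b}\<close> in auto)
    qed (use that in auto)
    then show ?thesis
      by (simp add: integral_unique)
  qed
  have "((\<lambda>u. f a + integral {a..u} f') has_real_derivative f' t) (at t within {a..b})"
    using DERIV_add[OF DERIV_const[of "f a"] integral_has_real_derivative[OF cont' t]] by simp
  then show ?thesis
    by (rule has_field_derivative_transform_within[OF _ zero_less_one t]) (rule eq)
qed

text \<open>Differentiating the scaled argument releases one factor \<open>w k\<close>; this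
  estimate absorbs it into the exponential envelope.\<close>

lemma mult_exp_norm_coordinate_le:
  fixes w :: "'k::finite \<Rightarrow> real"
  shows "\<bar>w k\<bar> * exp (K * (\<Sum>j\<in>UNIV. \<bar>w j\<bar>)) \<le> exp ((K + 1) * (\<Sum>j\<in>UNIV. \<bar>w j\<bar>))"
proof -
  have "\<bar>w k\<bar> \<le> (\<Sum>j\<in>UNIV. \<bar>w j\<bar>)"
    by (intro member_le_sum) auto
  also have "\<dots> \<le> exp (\<Sum>j\<in>UNIV. \<bar>w j\<bar>)"
    using exp_ge_add_one_self[of "\<Sum>j\<in>UNIV. \<bar>w j\<bar>"] by linarith
  finally show ?thesis
    by (simp add: algebra_simps exp_add)
qed

definition interp_coeff :: "'k set \<Rightarrow> real \<Rightarrow> 'k \<Rightarrow> real" where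
  "interp_coeff A t k = (if k \<in> A then sqrt t else sqrt (1 - t))"

lemma interp_coeff_le: "t \<in> {0..1} \<Longrightarrow> \<bar>interp_coeff A t k\<bar> \<le> 1"
  by (simp add: interp_coeff_def)

text \<open>The chain rule gives terms \<open>\<sigma>' * w k * \<Phi>1 k\<close>, and integration
  by parts exchanges \<open>w k\<close> for \<open>\<sigma>\<close> and one more derivative. Both
  the factor 1/2 and the signs stem from the product of \<open>\<sigma>'\<close> and
  \<open>\<sigma>\<close>. Differentiability and continuity are assumed along curves with
  coordinatewise regularity, so no derivative on the function space itself has to be
  defined.\<close>

theorem gaussian_interpolation:
  fixes \<Phi> :: "('k::finite \<Rightarrow> real) \<Rightarrow> real" and \<Phi>1 \<Phi>2 :: "'k \<Rightarrow> ('k \<Rightarrow> real) \<Rightarrow> real"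
  assumes grad: "\<And>(w :: real \<Rightarrow> 'k \<Rightarrow> real) w' u.
      (\<And>k. ((\<lambda>r. w r k) has_real_derivative w' k) (at u)) \<Longrightarrow>
      ((\<lambda>r. \<Phi> (w r)) has_real_derivative (\<Sum>k\<in>UNIV. \<Phi>1 k (w u) * w' k)) (at u)"
    and second: "\<And>k w r. ((\<lambda>r. \<Phi>1 k (w(k := r))) has_real_derivative \<Phi>2 k (w(k := r))) (at r)"
    and cont: "\<And>S (w :: real \<Rightarrow> 'k \<Rightarrow> real). (\<And>k. continuous_on S (\<lambda>r. w r k)) \<Longrightarrow>
      continuous_on S (\<lambda>r. \<Phi> (w r))"
    and cont2: "\<And>k S (w :: real \<Rightarrow> 'k \<Rightarrow> real). (\<And>k. continuous_on S (\<lambda>r. w r k)) \<Longrightarrow>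
      continuous_on S (\<lambda>r. \<Phi>2 k (w r))"
    and meas [measurable]: "\<Phi> \<in> borel_measurable (PiM UNIV (\<lambda>_. borel))"
      "\<And>k. \<Phi>1 k \<in> borel_measurable (PiM UNIV (\<lambda>_. borel))"
      "\<And>k. \<Phi>2 k \<in> borel_measurable (PiM UNIV (\<lambda>_. borel))"
    and bound: "exp_bounded \<Phi>" "\<And>k. exp_bounded (\<Phi>1 k)" "\<And>k. exp_bounded (\<Phi>2 k)"
    and t: "t \<in> {0..1}"
  shows "((\<lambda>t. \<integral>w. \<Phi> (\<lambda>k. interp_coeff A t k * w k) \<partial>std_normal_family) has_real_derivative
     1/2 * (\<Sum>k\<in>UNIV. (if k \<in> A then 1 else - 1) *
       (\<integral>w. \<Phi>2 k (\<lambda>k. interp_coeff A t k * w k) \<partial>std_normal_family))) (at t within {0..1})"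
proof -
  let ?P = "std_normal_family :: ('k \<Rightarrow> real) measure"
  let ?\<sigma> = "interp_coeff A"
  let ?N = "\<lambda>w :: 'k \<Rightarrow> real. \<Sum>k\<in>UNIV. \<bar>w k\<bar>"
  \<comment> \<open>The coefficients never exceed 1 in modulus, so the envelope of \<open>f\<close>
    itself dominates for all \<open>t\<close> in the closed interval at once. This serves both the
    expectation and the candidate \<open>D\<close> for its derivative.\<close>
  have cont_integral: "continuous_on {0..1} (\<lambda>t. \<integral>w. f (\<lambda>k. ?\<sigma> t k * w k) \<partial>?P)"
    if f: "exp_bounded f" and [measurable]: "f \<in> borel_measurable (PiM UNIV (\<lambda>_. borel))"
      and c: "\<And>S (w :: real \<Rightarrow> 'k \<Rightarrow> real). (\<And>k. continuous_on S (\<lambda>r. w r k)) \<Longrightarrow>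
        continuous_on S (\<lambda>r. f (w r))" for f
  proof -
    obtain C K where *: "C \<ge> 0" "K \<ge> 0" "\<And>w. \<bar>f w\<bar> \<le> C * exp (K * ?N w)"
      using f by (auto elim!: exp_boundedE)
    show ?thesis
    proof (rule continuous_on_integral)
      show "continuous_on {0..1} (\<lambda>t. f (\<lambda>k. ?\<sigma> t k * w k))" for w
      proof (rule c)
        show "continuous_on {0..1} (\<lambda>t. ?\<sigma> t k * w k)" for k
          by (cases "k \<in> A") (auto simp: interp_coeff_def intro!: continuous_intros)
      qed
      show "integrable ?P (\<lambda>w. C * exp (K * ?N w))"
        using integrable_exp_norm_std_normal_family by (intro integrable_mult_right)
      fix u :: real and w :: "'k \<Rightarrow> real" assume u: "u \<in> {0..1}"
      have "?N (\<lambda>k. ?\<sigma> u k * w k) \<le> ?N w"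
        unfolding abs_mult by (intro sum_mono mult_left_le_one_le interp_coeff_le[OF u]) auto
      then show "\<bar>f (\<lambda>k. ?\<sigma> u k * w k)\<bar> \<le> C * exp (K * ?N w)"
        using * by (intro order_trans[OF *(3)] mult_left_mono) (auto intro: mult_left_mono)
      show "(\<lambda>w. f (\<lambda>k. ?\<sigma> u k * w k)) \<in> borel_measurable ?P"
        by simp
    qed
  qed
  define D where "D = (\<lambda>t. 1/2 * (\<Sum>k\<in>UNIV. (if k \<in> A then 1 else - 1) *
       (\<integral>w. \<Phi>2 k (\<lambda>k. ?\<sigma> t k * w k) \<partial>?P)))"
  have "((\<lambda>t. \<integral>w. \<Phi> (\<lambda>k. ?\<sigma> t k * w k) \<partial>?P) has_real_derivative D u) (at u)"
    if u: "u \<in> {0<..<1}" for u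
  proof -
    \<comment> \<open>The interval from \<open>a\<close> to \<open>b\<close> surrounds
      \<open>u\<close> and stays away from 0 and 1, so the derivatives of the square roots are
      bounded on it by the constant \<open>B\<close>.\<close>
    define a b where "a = u / 2" and "b = (u + 1) / 2"
    have ab: "0 < a" "a < u" "u < b" "b < 1"
      using u by (auto simp: a_def b_def)
    define \<sigma>' where "\<sigma>' = (\<lambda>u k. if k \<in> A then inverse (sqrt u) / 2 else - (inverse (sqrt (1 - u)) / 2))"
    define B where "B = inverse (sqrt a) / 2 + inverse (sqrt (1 - b)) / 2"
    have B: "\<bar>\<sigma>' v k\<bar> \<le> B" if "v \<in> {a<..<b}" for v k
    proof -
      have "inverse (sqrt v) \<le> inverse (sqrt a)" "inverse (sqrt (1 - v)) \<le> inverse (sqrt (1 - b))"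
        using that ab by (auto intro!: le_imp_inverse_le)
      moreover have "inverse (sqrt v) \<ge> 0" "inverse (sqrt (1 - v)) \<ge> 0"
        using that ab by auto
      ultimately have "\<bar>inverse (sqrt v) / 2\<bar> \<le> B" "\<bar>- (inverse (sqrt (1 - v)) / 2)\<bar> \<le> B"
        unfolding B_def by linarith+
      then show ?thesis
        by (simp only: \<sigma>'_def split: if_split) simp
    qed
    have d\<sigma>: "((\<lambda>v. ?\<sigma> v k) has_real_derivative \<sigma>' v k) (at v)" if "v \<in> {a<..<b}" for v k
      using that ab by (auto simp: interp_coeff_def \<sigma>'_def intro!: derivative_eq_intros)
    have "\<exists>C K. C \<ge> 0 \<and> (\<forall>w. \<bar>\<Phi>1 k w\<bar> \<le> C * exp (K * ?N w)) \<and> K \<ge> 0" for k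
      using bound(2)[of k] unfolding exp_bounded_def by blast
    then obtain C K where CK: "\<And>k. C k \<ge> 0" "\<And>k w. \<bar>\<Phi>1 k w\<bar> \<le> C k * exp (K k * ?N w)" "\<And>k. K k \<ge> 0"
      by metis
    have le1: "\<bar>?\<sigma> v k\<bar> \<le> 1" if "v \<in> {a<..<b}" for v k
      using that ab by (intro interp_coeff_le) auto
    have "((\<lambda>t. \<integral>w. \<Phi> (\<lambda>k. ?\<sigma> t k * w k) \<partial>?P) has_real_derivative
      (\<integral>w. (\<Sum>k\<in>UNIV. \<Phi>1 k (\<lambda>k. ?\<sigma> u k * w k) * (\<sigma>' u k * w k)) \<partial>?P)) (at u)"
    proof (rule has_real_derivative_integral[OF ab(2,3)])
      fix v :: real assume v: "v \<in> {a<..<b}"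
      show "((\<lambda>t. \<Phi> (\<lambda>k. ?\<sigma> t k * w k)) has_real_derivative
          (\<Sum>k\<in>UNIV. \<Phi>1 k (\<lambda>k. ?\<sigma> v k * w k) * (\<sigma>' v k * w k))) (at v)" for w
        by (rule grad) (auto intro!: derivative_eq_intros d\<sigma>[OF v])
      show "integrable ?P (\<lambda>w. \<Phi> (\<lambda>k. ?\<sigma> v k * w k))"
        by (rule integrable_std_normal_family[OF exp_bounded_scale[OF bound(1) le1[OF v]]]) measurable
      show "\<bar>\<Sum>k\<in>UNIV. \<Phi>1 k (\<lambda>k. ?\<sigma> v k * w k) * (\<sigma>' v k * w k)\<bar>
          \<le> (\<Sum>k\<in>UNIV. C k * B * exp ((K k + 1) * ?N w))" for w
      proof (rule order_trans[OF sum_abs], rule sum_mono)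
        fix k
        have "?N (\<lambda>k. ?\<sigma> v k * w k) \<le> ?N w"
          unfolding abs_mult by (intro sum_mono mult_left_le_one_le le1[OF v]) auto
        then have 1: "\<bar>\<Phi>1 k (\<lambda>k. ?\<sigma> v k * w k)\<bar> \<le> C k * exp (K k * ?N w)"
          using CK by (intro order_trans[OF CK(2)] mult_left_mono) (auto intro: mult_left_mono)
        have "\<bar>\<Phi>1 k (\<lambda>k. ?\<sigma> v k * w k) * (\<sigma>' v k * w k)\<bar>
          \<le> (C k * exp (K k * ?N w)) * (B * \<bar>w k\<bar>)"
          unfolding abs_mult using CK(1) B[OF v, of k]
          by (intro mult_mono 1) auto
        also have "\<dots> = C k * B * (\<bar>w k\<bar> * exp (K k * ?N w))"
          by simp
        also have "\<dots> \<le> C k * B * exp ((K k + 1) * ?N w)"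
          using CK(1) order_trans[OF abs_ge_zero B[OF v, of k]]
          by (intro mult_left_mono mult_exp_norm_coordinate_le) auto
        finally show "\<bar>\<Phi>1 k (\<lambda>k. ?\<sigma> v k * w k) * (\<sigma>' v k * w k)\<bar> \<le> C k * B * exp ((K k + 1) * ?N w)" .
      qed
    next
      show "integrable ?P (\<lambda>w. \<Sum>k\<in>UNIV. C k * B * exp ((K k + 1) * ?N w))"
        by (intro Bochner_Integration.integrable_sum integrable_mult_right
            integrable_exp_norm_std_normal_family)
      show "(\<lambda>w. \<Sum>k\<in>UNIV. \<Phi>1 k (\<lambda>k. ?\<sigma> u k * w k) * (\<sigma>' u k * w k)) \<in> borel_measurable ?P"
        by simp
    qed
    also have "(\<integral>w. (\<Sum>k\<in>UNIV. \<Phi>1 k (\<lambda>k. ?\<sigma> u k * w k) * (\<sigma>' u k * w k)) \<partial>?P)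
        = (\<Sum>k\<in>UNIV. \<sigma>' u k * (\<integral>w. w k * \<Phi>1 k (\<lambda>k. ?\<sigma> u k * w k) \<partial>?P))"
    proof (subst Bochner_Integration.integral_sum)
      fix k
      show "integrable ?P (\<lambda>w. \<Phi>1 k (\<lambda>k. ?\<sigma> u k * w k) * (\<sigma>' u k * w k))"
      proof (rule integrable_std_normal_family)
        have "exp_bounded (\<lambda>w. \<Phi>1 k (\<lambda>k. ?\<sigma> u k * w k))"
          by (rule exp_bounded_scale[OF bound(2) le1]) (use ab in auto)
        then show "exp_bounded (\<lambda>w. \<Phi>1 k (\<lambda>k. ?\<sigma> u k * w k) * (\<sigma>' u k * w k))"
          by (intro exp_bounded_mult exp_bounded_const exp_bounded_coordinate)
      qed measurable
    qed (simp add: ac_simps flip: integral_mult_right_zero)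
    also have "\<dots> = (\<Sum>k\<in>UNIV. \<sigma>' u k * (?\<sigma> u k * (\<integral>w. \<Phi>2 k (\<lambda>k. ?\<sigma> u k * w k) \<partial>?P)))"
    proof (rule sum.cong[OF refl])
      fix k
      have "(\<integral>w. w k * \<Phi>1 k (\<lambda>k. ?\<sigma> u k * w k) \<partial>?P) = ?\<sigma> u k * (\<integral>w. \<Phi>2 k (\<lambda>k. ?\<sigma> u k * w k) \<partial>?P)"
      proof (rule stein_identity_family[OF second _ bound(2,3) meas(2,3) le1])
        show "continuous_on UNIV (\<lambda>r. \<Phi>2 k (w(k := r)))" for w
        proof (rule cont2)
          show "continuous_on UNIV (\<lambda>r. (w(k := r)) j)" for j
            by (cases "j = k") (auto intro: continuous_intros)
        qed
      qed (use ab in auto)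
      then show "\<sigma>' u k * (\<integral>w. w k * \<Phi>1 k (\<lambda>k. ?\<sigma> u k * w k) \<partial>?P)
        = \<sigma>' u k * (?\<sigma> u k * (\<integral>w. \<Phi>2 k (\<lambda>k. ?\<sigma> u k * w k) \<partial>?P))"
        by simp
    qed
    also have "\<dots> = D u"
    proof -
      \<comment> \<open>The product is half the derivative of the squared coefficient, which is
        \<open>t\<close> or \<open>1 - t\<close>; no singular factor remains.\<close>
      have "\<sigma>' u k * ?\<sigma> u k = 1/2 * (if k \<in> A then 1 else - 1)" for k
        using u by (simp add: \<sigma>'_def interp_coeff_def)
      then show ?thesis
        unfolding D_def sum_distrib_left by (intro sum.cong) (simp_all flip: mult.assoc)
    qed
    finally show ?thesis .
  qed
  moreover have "continuous_on {0..1} D"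
    unfolding D_def using bound meas
    by (intro continuous_on_mult continuous_on_const continuous_on_sum)
      (rule cont_integral[OF bound(3) meas(3) cont2])
  moreover have "continuous_on {0..1} (\<lambda>t. \<integral>w. \<Phi> (\<lambda>k. ?\<sigma> t k * w k) \<partial>?P)"
    by (rule cont_integral[OF bound(1) meas(1) cont])
  ultimately have "((\<lambda>t. \<integral>w. \<Phi> (\<lambda>k. ?\<sigma> t k * w k) \<partial>?P) has_real_derivative D t) (at t within {0..1})"
    by (intro has_real_derivative_closed_interval t)
  then show ?thesis
    unfolding D_def .
qed

subsection \<open>Nested exponential sums\<close>

text \<open>The vector \<open>v i j\<close> holds the coefficients of the linear form attached to
  the pair \<open>i\<close>, \<open>j\<close>. In the names below, the suffixes 1 and 2 mark the
  first and second partial derivatives in the coordinate \<open>k\<close>. Nonempty index sets keep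
  the inner sums \<open>Z\<close> and the outer sum \<open>S\<close> positive, where real powers are
  smooth.\<close>

locale exp_sum_functional =
  fixes I :: "'i set" and J :: "'j set" and v :: "'i \<Rightarrow> 'j \<Rightarrow> 'k::finite \<Rightarrow> real"
    and \<beta> s c :: real
  assumes I: "finite I" "I \<noteq> {}" and J: "finite J" "J \<noteq> {}"
begin

definition e :: "'i \<Rightarrow> 'j \<Rightarrow> ('k \<Rightarrow> real) \<Rightarrow> real" where
  "e i j w = exp (\<beta> * (\<Sum>k\<in>UNIV. v i j k * w k))"

definition Z :: "'i \<Rightarrow> ('k \<Rightarrow> real) \<Rightarrow> real" where
  "Z i w = (\<Sum>j\<in>J. e i j w)"

definition Z1 :: "'k \<Rightarrow> 'i \<Rightarrow> ('k \<Rightarrow> real) \<Rightarrow> real" where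
  "Z1 k i w = (\<Sum>j\<in>J. \<beta> * e i j w * v i j k)"

definition Z2 :: "'k \<Rightarrow> 'i \<Rightarrow> ('k \<Rightarrow> real) \<Rightarrow> real" where
  "Z2 k i w = (\<Sum>j\<in>J. \<beta>\<^sup>2 * e i j w * (v i j k)\<^sup>2)"

definition S :: "('k \<Rightarrow> real) \<Rightarrow> real" where
  "S w = (\<Sum>i\<in>I. Z i w powr s)"

definition S1 :: "'k \<Rightarrow> ('k \<Rightarrow> real) \<Rightarrow> real" where
  "S1 k w = (\<Sum>i\<in>I. s * Z i w powr (s - 1) * Z1 k i w)"

definition S2 :: "'k \<Rightarrow> ('k \<Rightarrow> real) \<Rightarrow> real" where
  "S2 k w = (\<Sum>i\<in>I. s * (s - 1) * Z i w powr (s - 2) * (Z1 k i w)\<^sup>2 + s * Z i w powr (s - 1) * Z2 k i w)"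

definition \<Phi> :: "('k \<Rightarrow> real) \<Rightarrow> real" where
  "\<Phi> w = S w powr c"

definition \<Phi>1 :: "'k \<Rightarrow> ('k \<Rightarrow> real) \<Rightarrow> real" where
  "\<Phi>1 k w = c * S w powr (c - 1) * S1 k w"

definition \<Phi>2 :: "'k \<Rightarrow> ('k \<Rightarrow> real) \<Rightarrow> real" where
  "\<Phi>2 k w = c * (c - 1) * S w powr (c - 2) * (S1 k w)\<^sup>2 + c * S w powr (c - 1) * S2 k w"

lemma e_pos: "e i j w > 0"
  by (simp add: e_def)

lemma Z_pos: "Z i w > 0"
  unfolding Z_def using J e_pos by (intro sum_pos) auto

lemma S_pos: "S w > 0"
  unfolding S_def using I Z_pos by (intro sum_pos) (auto simp: less_imp_neq[THEN not_sym])

section \<open>Measurability, growth and continuity of the functional\<close>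

lemma measurable_exp_sums [measurable]:
  "e i j \<in> borel_measurable (PiM UNIV (\<lambda>_. borel))"
  "Z i \<in> borel_measurable (PiM UNIV (\<lambda>_. borel))"
  "Z1 k i \<in> borel_measurable (PiM UNIV (\<lambda>_. borel))"
  "Z2 k i \<in> borel_measurable (PiM UNIV (\<lambda>_. borel))"
  "S \<in> borel_measurable (PiM UNIV (\<lambda>_. borel))"
  "S1 k \<in> borel_measurable (PiM UNIV (\<lambda>_. borel))"
  "S2 k \<in> borel_measurable (PiM UNIV (\<lambda>_. borel))"
  "\<Phi> \<in> borel_measurable (PiM UNIV (\<lambda>_. borel))"
  "\<Phi>1 k \<in> borel_measurable (PiM UNIV (\<lambda>_. borel))"
  "\<Phi>2 k \<in> borel_measurable (PiM UNIV (\<lambda>_. borel))"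
proof -
  show e [measurable]: "e i j \<in> borel_measurable (PiM UNIV (\<lambda>_. borel))" for i j
    unfolding e_def by measurable
  show Z [measurable]: "Z i \<in> borel_measurable (PiM UNIV (\<lambda>_. borel))" for i
    unfolding Z_def by measurable
  show Z1 [measurable]: "Z1 k i \<in> borel_measurable (PiM UNIV (\<lambda>_. borel))" for i
    unfolding Z1_def by measurable
  show Z2 [measurable]: "Z2 k i \<in> borel_measurable (PiM UNIV (\<lambda>_. borel))" for i
    unfolding Z2_def by measurable
  show S [measurable]: "S \<in> borel_measurable (PiM UNIV (\<lambda>_. borel))"
    unfolding S_def by measurable
  show S1 [measurable]: "S1 k \<in> borel_measurable (PiM UNIV (\<lambda>_. borel))"
    unfolding S1_def by measurable
  show S2 [measurable]: "S2 k \<in> borel_measurable (PiM UNIV (\<lambda>_. borel))"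
    unfolding S2_def by measurable
  show "\<Phi> \<in> borel_measurable (PiM UNIV (\<lambda>_. borel))"
    unfolding \<Phi>_def by measurable
  show "\<Phi>1 k \<in> borel_measurable (PiM UNIV (\<lambda>_. borel))"
    unfolding \<Phi>1_def by measurable
  show "\<Phi>2 k \<in> borel_measurable (PiM UNIV (\<lambda>_. borel))"
    unfolding \<Phi>2_def by measurable
qed

text \<open>Upper bounds are inherited term by term. For the inverses, a sum of positive terms is at
  least any one of them: a single \<open>e i j\<close> bounds \<open>Z i\<close> from below, and a
  single \<open>Z i w powr s\<close> bounds \<open>S\<close>.\<close>

lemma exp_bounded_exp_sums:
  shows exp_bounded_e: "exp_bounded (e i j)"
    and exp_bounded_Z_powr: "exp_bounded (\<lambda>w. Z i w powr a)"
    and exp_bounded_S_powr: "exp_bounded (\<lambda>w. S w powr a)"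
    and exp_bounded_\<Phi>: "exp_bounded \<Phi>"
    and exp_bounded_\<Phi>1: "exp_bounded (\<Phi>1 k)"
    and exp_bounded_\<Phi>2: "exp_bounded (\<Phi>2 k)"
proof -
  have e_eq: "e i j = (\<lambda>w. exp (\<Sum>k\<in>UNIV. (\<beta> * v i j k) * w k))" for i j
    by (simp add: e_def fun_eq_iff sum_distrib_left mult.assoc)
  show e: "exp_bounded (e i j)" for i j
    unfolding e_eq by (rule exp_bounded_exp_linear)
  have inv_e: "exp_bounded (\<lambda>w. inverse (e i j w))" for i j
  proof -
    have "inverse (e i j w) = exp (\<Sum>k\<in>UNIV. (- (\<beta> * v i j k)) * w k)" for w
      by (simp add: e_eq sum_negf flip: exp_minus)
    then show ?thesis
      by (simp only: exp_bounded_exp_linear)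
  qed
  show Z_powr: "exp_bounded (\<lambda>w. Z i w powr a)" for i a
  proof (rule exp_bounded_powr)
    show "exp_bounded (Z i)"
      unfolding Z_def by (intro exp_bounded_sum e)
    obtain j where j: "j \<in> J"
      using J by auto
    show "exp_bounded (\<lambda>w. inverse (Z i w))"
    proof (rule exp_bounded_mono[OF inv_e])
      show "\<bar>inverse (Z i w)\<bar> \<le> \<bar>inverse (e i j w)\<bar>" for w
      proof -
        have "e i j w \<le> Z i w"
          unfolding Z_def using J j e_pos by (intro member_le_sum) (auto intro: less_imp_le)
        then show ?thesis
          using e_pos[of i j w] Z_pos[of i w] by (simp add: le_imp_inverse_le)
      qed
    qed
  qed (rule Z_pos)
  show S_powr: "exp_bounded (\<lambda>w. S w powr a)" for a
  proof (rule exp_bounded_powr)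
    show "exp_bounded S"
      unfolding S_def by (intro exp_bounded_sum Z_powr)
    obtain i where i: "i \<in> I"
      using I by auto
    show "exp_bounded (\<lambda>w. inverse (S w))"
    proof (rule exp_bounded_mono[OF Z_powr])
      show "\<bar>inverse (S w)\<bar> \<le> \<bar>Z i w powr (- s)\<bar>" for w
      proof -
        have "Z i w powr s \<le> S w"
          unfolding S_def using I i by (intro member_le_sum) auto
        then show ?thesis
          using Z_pos[of i w] S_pos[of w] by (simp add: powr_minus le_imp_inverse_le)
      qed
    qed
  qed (rule S_pos)
  have Z1: "exp_bounded (Z1 k i)" and Z2: "exp_bounded (Z2 k i)" for k i
    unfolding Z1_def Z2_def
    by (intro exp_bounded_sum exp_bounded_mult exp_bounded_const e)+
  have S1: "exp_bounded (S1 k)" and S2: "exp_bounded (S2 k)" for k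
    unfolding S1_def S2_def
    by (intro exp_bounded_sum exp_bounded_add exp_bounded_mult exp_bounded_power2
        exp_bounded_const Z1 Z2 Z_powr)+
  show "exp_bounded \<Phi>" "exp_bounded (\<Phi>1 k)" "exp_bounded (\<Phi>2 k)"
    unfolding \<Phi>_def \<Phi>1_def \<Phi>2_def
    by (intro exp_bounded_sum exp_bounded_add exp_bounded_mult exp_bounded_power2
        exp_bounded_const S1 S2 S_powr)+
qed

lemma continuous_exp_sums:
  assumes w: "\<And>k. continuous_on A (\<lambda>r. w r k)"
  shows "continuous_on A (\<lambda>r. \<Phi> (w r))" "continuous_on A (\<lambda>r. \<Phi>2 k (w r))"
proof -
  have e: "continuous_on A (\<lambda>r. e i j (w r))" for i j
    unfolding e_def by (intro continuous_intros w)
  have Z: "continuous_on A (\<lambda>r. Z i (w r))" and Z1: "continuous_on A (\<lambda>r. Z1 k i (w r))"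
    and Z2: "continuous_on A (\<lambda>r. Z2 k i (w r))" for i k
    unfolding Z_def Z1_def Z2_def by (intro continuous_intros e)+
  have "Z i (w r) \<noteq> 0" for i r
    using Z_pos[of i "w r"] by simp
  then have Z_powr: "continuous_on A (\<lambda>r. Z i (w r) powr a)" for i a
    by (intro continuous_on_powr Z continuous_intros) auto
  have S: "continuous_on A (\<lambda>r. S (w r))" and S1: "continuous_on A (\<lambda>r. S1 k (w r))"
    and S2: "continuous_on A (\<lambda>r. S2 k (w r))" for k
    unfolding S_def S1_def S2_def by (intro continuous_intros Z_powr Z1 Z2)+
  have "S (w r) \<noteq> 0" for r
    using S_pos[of "w r"] by simp
  then have S_powr: "continuous_on A (\<lambda>r. S (w r) powr a)" for a
    by (intro continuous_on_powr S continuous_intros) auto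
  show "continuous_on A (\<lambda>r. \<Phi> (w r))" "continuous_on A (\<lambda>r. \<Phi>2 k (w r))"
    unfolding \<Phi>_def \<Phi>2_def by (intro continuous_intros S_powr S1 S2)+
qed

section \<open>Derivatives of the functional\<close>

lemma has_real_derivative_\<Phi>:
  assumes w: "\<And>k. ((\<lambda>r. w r k) has_real_derivative w' k) (at u)"
  shows "((\<lambda>r. \<Phi> (w r)) has_real_derivative (\<Sum>k\<in>UNIV. \<Phi>1 k (w u) * w' k)) (at u)"
proof -
  have e: "((\<lambda>r. e i j (w r)) has_real_derivative
      (\<Sum>k\<in>UNIV. \<beta> * e i j (w u) * v i j k * w' k)) (at u)" for i j
    unfolding e_def
    by (auto intro!: derivative_eq_intros w simp: sum_distrib_left sum_distrib_right ac_simps)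
  have Z: "((\<lambda>r. Z i (w r)) has_real_derivative (\<Sum>k\<in>UNIV. Z1 k i (w u) * w' k)) (at u)" for i
    unfolding Z_def Z1_def sum_distrib_right
    by (subst sum.swap) (intro DERIV_sum e)
  have S: "((\<lambda>r. S (w r)) has_real_derivative (\<Sum>k\<in>UNIV. S1 k (w u) * w' k)) (at u)"
  proof -
    have "((\<lambda>r. S (w r)) has_real_derivative
        (\<Sum>i\<in>I. s * Z i (w u) powr (s - of_nat 1) * (\<Sum>k\<in>UNIV. Z1 k i (w u) * w' k))) (at u)"
      unfolding S_def by (intro DERIV_sum DERIV_fun_powr Z Z_pos)
    then show ?thesis
      unfolding S1_def sum_distrib_right sum_distrib_left
      by (subst sum.swap) (simp add: mult.assoc)
  qed
  have "((\<lambda>r. \<Phi> (w r)) has_real_derivative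
      c * S (w u) powr (c - of_nat 1) * (\<Sum>k\<in>UNIV. S1 k (w u) * w' k)) (at u)"
    unfolding \<Phi>_def by (intro DERIV_fun_powr S S_pos)
  then show ?thesis
    unfolding \<Phi>1_def sum_distrib_left by (simp add: mult.assoc)
qed

lemma has_real_derivative_\<Phi>1:
  "((\<lambda>r. \<Phi>1 k (w(k := r))) has_real_derivative \<Phi>2 k (w(k := r))) (at r)"
proof -
  let ?w = "\<lambda>r. w(k := r)"
  have lin: "(\<Sum>l\<in>UNIV. v i j l * (?w r) l) = v i j k * r + (\<Sum>l\<in>UNIV-{k}. v i j l * w l)" for i j r
    by (subst sum.remove[of _ k]) auto
  have e: "((\<lambda>r. e i j (?w r)) has_real_derivative \<beta> * e i j (?w r) * v i j k) (at r)" for i j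
    unfolding e_def lin by (auto intro!: derivative_eq_intros)
  have Z: "((\<lambda>r. Z i (?w r)) has_real_derivative Z1 k i (?w r)) (at r)" for i
    unfolding Z_def Z1_def by (intro DERIV_sum e)
  have Z1: "((\<lambda>r. Z1 k i (?w r)) has_real_derivative Z2 k i (?w r)) (at r)" for i
    unfolding Z1_def Z2_def
    by (rule DERIV_sum) (auto intro!: derivative_eq_intros e simp: power2_eq_square)
  have S: "((\<lambda>r. S (?w r)) has_real_derivative S1 k (?w r)) (at r)"
    unfolding S_def S1_def
  proof (rule DERIV_sum)
    show "((\<lambda>r. Z i (?w r) powr s) has_real_derivative s * Z i (?w r) powr (s - 1) * Z1 k i (?w r)) (at r)" for i
      using DERIV_fun_powr[OF Z Z_pos, where r = s] by (simp only: of_nat_1)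
  qed
  have S1: "((\<lambda>r. S1 k (?w r)) has_real_derivative S2 k (?w r)) (at r)"
    unfolding S1_def S2_def
  proof (rule DERIV_sum)
    fix i
    have "((\<lambda>r. Z i (?w r) powr (s - 1)) has_real_derivative
        (s - 1) * Z i (?w r) powr (s - 2) * Z1 k i (?w r)) (at r)"
      using DERIV_fun_powr[OF Z Z_pos, of i "s - 1"] by (simp add: algebra_simps fun_upd_def)
    from DERIV_mult[OF DERIV_cmult[OF this, of s] Z1]
    show "((\<lambda>r. s * Z i (?w r) powr (s - 1) * Z1 k i (?w r)) has_real_derivative
        s * (s - 1) * Z i (?w r) powr (s - 2) * (Z1 k i (?w r))\<^sup>2 + s * Z i (?w r) powr (s - 1) * Z2 k i (?w r)) (at r)"
      by (simp add: power2_eq_square algebra_simps)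
  qed
  have "((\<lambda>r. S (?w r) powr (c - 1)) has_real_derivative
      (c - 1) * S (?w r) powr (c - 2) * S1 k (?w r)) (at r)"
    using DERIV_fun_powr[OF S S_pos, of "c - 1"] by (simp add: algebra_simps fun_upd_def)
  from DERIV_mult[OF DERIV_cmult[OF this, of c] S1]
  show ?thesis
    unfolding \<Phi>1_def \<Phi>2_def by (simp add: power2_eq_square algebra_simps)
qed

text \<open>Here the coordinates disappear: a signed sum of squared partial derivatives turns into a
  quadratic form whose coefficients are covariance differences.\<close>

lemma sum_quadratic_form:
  fixes q :: "'p \<Rightarrow> real" and a :: "'p \<Rightarrow> 'k \<Rightarrow> real"
  shows "(\<Sum>k\<in>UNIV. \<epsilon> k * (\<Sum>p\<in>T. q p * a p k)\<^sup>2)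
    = (\<Sum>p\<in>T. \<Sum>p'\<in>T. q p * q p' * (\<Sum>k\<in>UNIV. \<epsilon> k * a p k * a p' k))"
proof -
  have "(\<Sum>k\<in>UNIV. \<epsilon> k * (\<Sum>p\<in>T. q p * a p k)\<^sup>2)
      = (\<Sum>k\<in>UNIV. \<Sum>p\<in>T. \<Sum>p'\<in>T. q p * q p' * (\<epsilon> k * a p k * a p' k))"
    by (simp add: power2_eq_square sum_product sum_distrib_left ac_simps)
  also have "\<dots> = (\<Sum>p\<in>T. \<Sum>k\<in>UNIV. \<Sum>p'\<in>T. q p * q p' * (\<epsilon> k * a p k * a p' k))"
    by (rule sum.swap)
  also have "\<dots> = (\<Sum>p\<in>T. \<Sum>p'\<in>T. \<Sum>k\<in>UNIV. q p * q p' * (\<epsilon> k * a p k * a p' k))"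
    by (intro sum.cong refl) (rule sum.swap)
  finally show ?thesis
    by (simp add: sum_distrib_left)
qed

text \<open>Equal covariances within one group \<open>i\<close> cancel everything that involves a
  single inner sum, both the squares of \<open>Z1\<close> and \<open>Z2\<close>. Hence
  \<open>S2\<close> drops out, and with it the term whose prefactor is \<open>c\<close>; what
  remains carries \<open>c * (c - 1)\<close>.\<close>

lemma sum_signed_\<Phi>2:
  assumes \<Delta>: "\<And>i j j'. i \<in> I \<Longrightarrow> j \<in> J \<Longrightarrow> j' \<in> J \<Longrightarrow> (\<Sum>k\<in>UNIV. \<epsilon> k * v i j k * v i j' k) = 0"
  shows "(\<Sum>k\<in>UNIV. \<epsilon> k * \<Phi>2 k w) = c * (c - 1) * S w powr (c - 2) *
    (\<Sum>(i, j)\<in>I \<times> J. \<Sum>(i', j')\<in>I \<times> J.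
      (s * Z i w powr (s - 1) * \<beta> * e i j w) * (s * Z i' w powr (s - 1) * \<beta> * e i' j' w) *
      (\<Sum>k\<in>UNIV. \<epsilon> k * v i j k * v i' j' k))"
proof -
  have Z1: "(\<Sum>k\<in>UNIV. \<epsilon> k * (Z1 k i w)\<^sup>2) = 0" if "i \<in> I" for i
    unfolding Z1_def using that
    by (subst sum_quadratic_form) (auto intro!: sum.neutral simp: \<Delta>)
  have Z2: "(\<Sum>k\<in>UNIV. \<epsilon> k * Z2 k i w) = 0" if "i \<in> I" for i
  proof -
    have "(\<Sum>k\<in>UNIV. \<epsilon> k * Z2 k i w) = (\<Sum>j\<in>J. \<Sum>k\<in>UNIV. \<beta>\<^sup>2 * e i j w * (\<epsilon> k * v i j k * v i j k))"
      unfolding Z2_def sum_distrib_left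
      by (subst sum.swap) (simp add: power2_eq_square ac_simps)
    also have "\<dots> = 0"
      using that by (intro sum.neutral) (simp add: \<Delta> flip: sum_distrib_left)
    finally show ?thesis .
  qed
  have S2: "(\<Sum>k\<in>UNIV. \<epsilon> k * S2 k w) = 0"
  proof -
    have "(\<Sum>k\<in>UNIV. \<epsilon> k * S2 k w) = (\<Sum>i\<in>I. s * (s - 1) * Z i w powr (s - 2) * (\<Sum>k\<in>UNIV. \<epsilon> k * (Z1 k i w)\<^sup>2)
        + s * Z i w powr (s - 1) * (\<Sum>k\<in>UNIV. \<epsilon> k * Z2 k i w))"
      unfolding S2_def sum_distrib_left sum.distrib[symmetric]
      by (subst sum.swap) (simp add: algebra_simps)
    then show ?thesis
      by (simp add: Z1 Z2)
  qed
  have "S1 k w = (\<Sum>(i, j)\<in>I \<times> J. (s * Z i w powr (s - 1) * \<beta> * e i j w) * v i j k)" for k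
    unfolding S1_def Z1_def sum_distrib_left sum.cartesian_product by (simp add: ac_simps)
  then have "(\<Sum>k\<in>UNIV. \<epsilon> k * (S1 k w)\<^sup>2) = (\<Sum>(i, j)\<in>I \<times> J. \<Sum>(i', j')\<in>I \<times> J.
      (s * Z i w powr (s - 1) * \<beta> * e i j w) * (s * Z i' w powr (s - 1) * \<beta> * e i' j' w) *
      (\<Sum>k\<in>UNIV. \<epsilon> k * v i j k * v i' j' k))"
    using sum_quadratic_form[of \<epsilon> "\<lambda>(i, j). s * Z i w powr (s - 1) * \<beta> * e i j w" "\<lambda>(i, j). v i j" "I \<times> J"]
    by (simp add: case_prod_beta)
  moreover have "(\<Sum>k\<in>UNIV. \<epsilon> k * \<Phi>2 k w)
      = c * (c - 1) * S w powr (c - 2) * (\<Sum>k\<in>UNIV. \<epsilon> k * (S1 k w)\<^sup>2)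
        + c * S w powr (c - 1) * (\<Sum>k\<in>UNIV. \<epsilon> k * S2 k w)"
    unfolding \<Phi>2_def sum_distrib_left sum.distrib[symmetric] by (simp add: algebra_simps)
  ultimately show ?thesis
    by (simp add: S2)
qed

text \<open>Collecting the coordinate integrals into one lets the signed sum of second derivatives
  be rewritten pointwise before integrating.\<close>

lemma has_real_derivative_integral_\<Phi>:
  assumes "t \<in> {0..1}"
  shows "((\<lambda>t. \<integral>w. \<Phi> (\<lambda>k. interp_coeff A t k * w k) \<partial>std_normal_family) has_real_derivative
     1/2 * (\<integral>w. (\<Sum>k\<in>UNIV. (if k \<in> A then 1 else - 1) *
       \<Phi>2 k (\<lambda>k. interp_coeff A t k * w k)) \<partial>std_normal_family)) (at t within {0..1})"
proof -
  have "integrable std_normal_family (\<lambda>w. \<Phi>2 k (\<lambda>k. interp_coeff A t k * w k))" for k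
    using interp_coeff_le[OF assms]
    by (intro integrable_std_normal_family exp_bounded_scale exp_bounded_\<Phi>2) auto
  then have "(\<integral>w. (\<Sum>k\<in>UNIV. (if k \<in> A then 1 else - 1) *
       \<Phi>2 k (\<lambda>k. interp_coeff A t k * w k)) \<partial>std_normal_family)
     = (\<Sum>k\<in>UNIV. (if k \<in> A then 1 else - 1) *
       (\<integral>w. \<Phi>2 k (\<lambda>k. interp_coeff A t k * w k) \<partial>std_normal_family))"
    by (subst Bochner_Integration.integral_sum) (auto intro!: sum.cong)
  then show ?thesis
    using gaussian_interpolation[OF has_real_derivative_\<Phi> has_real_derivative_\<Phi>1
        continuous_exp_sums measurable_exp_sums(8,9,10)
        exp_bounded_\<Phi> exp_bounded_\<Phi>1 exp_bounded_\<Phi>2 assms, where A = A]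
    by (simp only:)
qed

text \<open>This is the signed sum of second derivatives with \<open>c * (c - 1)\<close> divided
  out, so that \<open>c\<close> alone decides the sign of the derivative.\<close>

definition quad :: "('k \<Rightarrow> real) \<Rightarrow> ('k \<Rightarrow> real) \<Rightarrow> real" where
  "quad \<epsilon> w = S w powr (c - 2) *
    (\<Sum>(i, j)\<in>I \<times> J. \<Sum>(i', j')\<in>I \<times> J.
      (s * Z i w powr (s - 1) * \<beta> * e i j w) * (s * Z i' w powr (s - 1) * \<beta> * e i' j' w) *
      (\<Sum>k\<in>UNIV. \<epsilon> k * v i j k * v i' j' k))"

lemma exp_bounded_quad: "exp_bounded (quad \<epsilon>)"
  unfolding quad_def case_prod_beta
  by (intro exp_bounded_mult exp_bounded_sum exp_bounded_const exp_bounded_e exp_bounded_Z_powr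
      exp_bounded_S_powr)

lemma measurable_quad [measurable]: "quad \<epsilon> \<in> borel_measurable (PiM UNIV (\<lambda>_. borel))"
  unfolding quad_def case_prod_beta by measurable

text \<open>Both weights carry the factor \<open>s * \<beta>\<close>; it enters as a square, so the
  sign of \<open>s\<close> has no influence.\<close>

lemma quad_term_eq:
  "(s * Z i w powr (s - 1) * \<beta> * e i j w) * (s * Z i' w powr (s - 1) * \<beta> * e i' j' w) * r
    = (s * \<beta>)\<^sup>2 * (Z i w powr (s - 1) * e i j w * Z i' w powr (s - 1) * e i' j' w) * r"
  by (simp add: power2_eq_square)

text \<open>All weights are positive apart from the square of \<open>s * \<beta>\<close>, so the
  double sum inherits the sign of the covariance differences. One positive entry among nonnegative
  ones makes first its row and then the whole sum positive.\<close>

lemma quad_nonneg_pos: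
  assumes nonneg: "\<And>i i' j j'. 0 \<le> (\<Sum>k\<in>UNIV. \<epsilon> k * v i j k * v i' j' k)"
  shows quad_nonneg: "quad \<epsilon> w \<ge> 0"
    and quad_pos: "\<lbrakk>i \<in> I; j \<in> J; i' \<in> I; j' \<in> J; 0 < (\<Sum>k\<in>UNIV. \<epsilon> k * v i j k * v i' j' k);
      s \<noteq> 0; \<beta> \<noteq> 0\<rbrakk> \<Longrightarrow> quad \<epsilon> w > 0"
proof -
  define T where "T = (\<lambda>p p'. (s * \<beta>)\<^sup>2 * (Z (fst p) w powr (s - 1) * e (fst p) (snd p) w *
    Z (fst p') w powr (s - 1) * e (fst p') (snd p') w) *
    (\<Sum>k\<in>UNIV. \<epsilon> k * v (fst p) (snd p) k * v (fst p') (snd p') k))"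
  have quad: "quad \<epsilon> w = S w powr (c - 2) * (\<Sum>p\<in>I \<times> J. \<Sum>p'\<in>I \<times> J. T p p')"
    unfolding quad_def quad_term_eq case_prod_beta T_def ..
  have fin: "finite (I \<times> J)"
    using I J by simp
  have T: "0 \<le> T p p'" for p p'
  proof -
    have "0 \<le> e (fst p) (snd p) w" "0 \<le> e (fst p') (snd p') w"
      using e_pos by (auto intro: less_imp_le)
    then show ?thesis
      unfolding T_def by (intro mult_nonneg_nonneg nonneg) auto
  qed
  have inner: "0 \<le> (\<Sum>p'\<in>I \<times> J. T p p')" for p
    by (intro sum_nonneg T)
  show "quad \<epsilon> w \<ge> 0"
    unfolding quad by (intro mult_nonneg_nonneg sum_nonneg T) auto
  assume *: "i \<in> I" "j \<in> J" "i' \<in> I" "j' \<in> J" "0 < (\<Sum>k\<in>UNIV. \<epsilon> k * v i j k * v i' j' k)"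
    "s \<noteq> 0" "\<beta> \<noteq> 0"
  have pos: "Z i w powr (s - 1) * e i j w * Z i' w powr (s - 1) * e i' j' w > 0"
    using Z_pos[of i w] Z_pos[of i' w] by (intro mult_pos_pos e_pos) auto
  have "0 < T (i, j) (i', j')"
    unfolding T_def fst_conv snd_conv using *(6,7) by (intro mult_pos_pos[OF mult_pos_pos[OF _ pos] *(5)]) auto
  then have "0 < (\<Sum>p'\<in>I \<times> J. T (i, j) p')"
    by (rule sum_pos2[OF fin, rotated]) (use * T in auto)
  then have "0 < (\<Sum>p\<in>I \<times> J. \<Sum>p'\<in>I \<times> J. T p p')"
    by (rule sum_pos2[OF fin, rotated]) (use * inner in auto)
  then show "quad \<epsilon> w > 0"
    unfolding quad using S_pos[of w] by (intro mult_pos_pos) auto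
qed

text \<open>The witness \<open>D\<close> is half the expectation of \<open>quad\<close>. In the
  strict case the integrand is positive at every point, hence so is its expectation under a
  probability measure.\<close>

lemma has_real_derivative_integral_\<Phi>_signed:
  fixes A :: "'k set" and t :: real
  assumes t: "t \<in> {0..1}"
  defines "\<epsilon> \<equiv> \<lambda>k. if k \<in> A then 1 else - 1"
  assumes nonneg: "\<And>i i' j j'. 0 \<le> (\<Sum>k\<in>UNIV. \<epsilon> k * v i j k * v i' j' k)"
    and diag: "\<And>i j j'. (\<Sum>k\<in>UNIV. \<epsilon> k * v i j k * v i j' k) = 0"
  obtains D where
    "((\<lambda>t. \<integral>w. \<Phi> (\<lambda>k. interp_coeff A t k * w k) \<partial>std_normal_family) has_real_derivative c * (c - 1) * D)
      (at t within {0..1})"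
    "D \<ge> 0"
    "(\<exists>i\<in>I. \<exists>i'\<in>I. \<exists>j\<in>J. \<exists>j'\<in>J. 0 < (\<Sum>k\<in>UNIV. \<epsilon> k * v i j k * v i' j' k)) \<Longrightarrow>
      s \<noteq> 0 \<Longrightarrow> \<beta> \<noteq> 0 \<Longrightarrow> D > 0"
proof
  let ?P = "std_normal_family :: ('k \<Rightarrow> real) measure"
  interpret P: prob_space ?P
    by (rule prob_space_std_normal_family)
  let ?q = "\<lambda>w. quad \<epsilon> (\<lambda>k. interp_coeff A t k * w k)"
  let ?D = "1/2 * (\<integral>w. ?q w \<partial>?P)"
  have eq: "(\<Sum>k\<in>UNIV. (if k \<in> A then 1 else - 1) * \<Phi>2 k w) = c * (c - 1) * quad \<epsilon> w" for w
    using sum_signed_\<Phi>2[of \<epsilon> w] diag unfolding quad_def \<epsilon>_def by (simp add: mult.assoc)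
  show "((\<lambda>t. \<integral>w. \<Phi> (\<lambda>k. interp_coeff A t k * w k) \<partial>?P) has_real_derivative c * (c - 1) * ?D)
      (at t within {0..1})"
    using has_real_derivative_integral_\<Phi>[OF t, of A] unfolding eq by simp
  show "?D \<ge> 0"
    using quad_nonneg[OF nonneg] by (simp add: Bochner_Integration.integral_nonneg)
  have int: "integrable ?P ?q"
    by (rule integrable_std_normal_family[OF exp_bounded_scale[OF exp_bounded_quad interp_coeff_le[OF t]]])
      measurable
  show "?D > 0"
    if ex: "\<exists>i\<in>I. \<exists>i'\<in>I. \<exists>j\<in>J. \<exists>j'\<in>J. 0 < (\<Sum>k\<in>UNIV. \<epsilon> k * v i j k * v i' j' k)"
      and nz: "s \<noteq> 0" "\<beta> \<noteq> 0"
  proof -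
    obtain i i' j j' where *: "i \<in> I" "j \<in> J" "i' \<in> I" "j' \<in> J"
      "0 < (\<Sum>k\<in>UNIV. \<epsilon> k * v i j k * v i' j' k)"
      using ex by blast
    have "0 < (\<integral>w. ?q w \<partial>?P)"
      using quad_pos[OF nonneg * nz] by (intro P.expectation_greater[OF int]) auto
    then show ?thesis by simp
  qed
qed

end

subsection \<open>The limit of large inverse temperature\<close>

text \<open>The interval from \<open>1 / B\<close> to \<open>B\<close> is invariant under inversion,
  so positive and negative exponents are treated alike and only the modulus of \<open>c\<close>
  enters the new bound.\<close>

lemma powr_between:
  fixes B x c :: real
  assumes "B > 0" "1 / B \<le> x" "x \<le> B"
  shows "1 / B powr \<bar>c\<bar> \<le> x powr c" "x powr c \<le> B powr \<bar>c\<bar>"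
proof -
  have x: "x > 0"
    using assms by (meson divide_pos_pos less_le_trans zero_less_one)
  have pos: "1 / B powr a \<le> x powr a \<and> x powr a \<le> B powr a" if "a \<ge> 0" for a
  proof -
    have "(1 / B) powr a \<le> x powr a" "x powr a \<le> B powr a"
      using assms x that by (auto intro!: powr_mono2)
    then show ?thesis
      using assms by (simp add: powr_divide)
  qed
  have "1 / B powr \<bar>c\<bar> \<le> x powr c \<and> x powr c \<le> B powr \<bar>c\<bar>"
  proof (cases "c \<ge> 0")
    case False
    then have eq: "x powr c = 1 / x powr \<bar>c\<bar>"
      by (simp add: powr_minus_divide[of x "- c", simplified])
    have "x powr \<bar>c\<bar> > 0" "B powr \<bar>c\<bar> > 0"
      using x assms by auto
    then show ?thesis
      unfolding eq using pos[of "\<bar>c\<bar>"] by (simp add: field_simps)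
  qed (use pos in auto)
  then show "1 / B powr \<bar>c\<bar> \<le> x powr c" "x powr c \<le> B powr \<bar>c\<bar>"
    by auto
qed

lemma tendsto_exp_mult_nonpos:
  fixes a :: real
  assumes "a \<le> 0"
  shows "((\<lambda>b. exp (b * a)) \<longlongrightarrow> (if a = 0 then 1 else 0)) at_top"
proof (cases "a = 0")
  case False
  then have "filterlim (\<lambda>b. b * a) at_bot at_top"
    using assms filterlim_tendsto_neg_mult_at_bot[OF tendsto_const, of a "\<lambda>b. b" at_top]
    by (simp add: filterlim_ident mult.commute)
  then show ?thesis
    using False by (auto intro: filterlim_compose[OF exp_at_bot])
qed auto

text \<open>Factoring out the dominant exponential leaves a factor that is bounded away from \<open>0\<close> and
  \<open>\<infinity>\<close> and converges, so the behaviour for large \<open>b\<close> is governed by the sign of the exponent.\<close>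

lemma nested_exp_sum_asymptotics:
  fixes a :: "'i \<Rightarrow> 'j \<Rightarrow> real" and s c :: real
  assumes I: "finite I" "I \<noteq> {}" and J: "finite J" "J \<noteq> {}"
  defines "m \<equiv> \<lambda>i. Max ((\<lambda>j. a i j) ` J)"
  defines "\<mu> \<equiv> Max ((\<lambda>i. s * m i) ` I)"
  defines "g \<equiv> \<lambda>b. (\<Sum>i\<in>I. exp (b * (s * m i - \<mu>)) * (\<Sum>j\<in>J. exp (b * (a i j - m i))) powr s) powr c"
  defines "B \<equiv> (card I * card J powr \<bar>s\<bar>) powr \<bar>c\<bar>"
  shows "(\<Sum>i\<in>I. (\<Sum>j\<in>J. exp (b * a i j)) powr s) powr c = exp (b * (c * \<mu>)) * g b"
    and "b \<ge> 0 \<Longrightarrow> 1 / B \<le> g b" and "b \<ge> 0 \<Longrightarrow> g b \<le> B" and "\<exists>L. (g \<longlongrightarrow> L) at_top"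
proof -
  define Z where "Z = (\<lambda>i b. \<Sum>j\<in>J. exp (b * (a i j - m i)))"
  define T where "T = (\<lambda>b. \<Sum>i\<in>I. exp (b * (s * m i - \<mu>)) * Z i b powr s)"
  have g: "g b = T b powr c" for b
    by (simp add: g_def T_def Z_def)
  have m: "a i j \<le> m i" if "j \<in> J" for i j
    unfolding m_def using J that by (intro Max_ge) auto
  have "\<exists>j. j \<in> J \<and> a i j = m i" for i
  proof -
    have "m i \<in> (\<lambda>j. a i j) ` J"
      unfolding m_def using J by (intro Max_in) auto
    then show ?thesis by auto
  qed
  then obtain jm where jm: "\<And>i. jm i \<in> J" "\<And>i. a i (jm i) = m i"
    by metis
  have \<mu>: "s * m i \<le> \<mu>" if "i \<in> I" for i
    unfolding \<mu>_def using I that by (intro Max_ge) auto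
  have "\<mu> \<in> (\<lambda>i. s * m i) ` I"
    unfolding \<mu>_def using I by (intro Max_in) auto
  then obtain im where im: "im \<in> I" "s * m im = \<mu>"
    by auto
  \<comment> \<open>The maximising index \<open>jm i\<close> contributes exactly
    \<open>exp 0 = 1\<close>. For nonnegative \<open>b\<close> every other term is at most 1, which
    gives the upper bound \<open>card J\<close>.\<close>
  have Z_ge: "1 \<le> Z i b" for i b
    unfolding Z_def using J jm member_le_sum[of "jm i" J "\<lambda>j. exp (b * (a i j - m i))"] by simp
  have Z_le: "Z i b \<le> card J" if "b \<ge> 0" for i b
    unfolding Z_def using m that J
    by (intro order_trans[OF sum_bounded_above[where K = 1]]) (auto simp: mult_nonneg_nonpos)
  have T_pos: "T b > 0" for b
  proof -
    have "Z i b powr s > 0" for i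
      using Z_ge[of i b] by simp
    then show ?thesis
      unfolding T_def using I by (intro sum_pos) auto
  qed
  have "(\<Sum>i\<in>I. (\<Sum>j\<in>J. exp (b * a i j)) powr s) = exp (b * \<mu>) * T b"
  proof -
    have *: "(\<Sum>j\<in>J. exp (b * a i j)) = exp (b * m i) * Z i b" for i
      unfolding Z_def sum_distrib_left by (simp add: algebra_simps flip: exp_add)
    have "(\<Sum>j\<in>J. exp (b * a i j)) powr s = exp (b * \<mu>) * (exp (b * (s * m i - \<mu>)) * Z i b powr s)" for i
    proof -
      have "exp (b * m i) powr s = exp (b * \<mu>) * exp (b * (s * m i - \<mu>))"
        unfolding exp_powr_real exp_add[symmetric] by (simp add: algebra_simps)
      then show ?thesis
        using *[of i] Z_ge[of i b] by (simp add: powr_mult mult.assoc)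
    qed
    then show ?thesis
      by (simp add: T_def sum_distrib_left)
  qed
  then show "(\<Sum>i\<in>I. (\<Sum>j\<in>J. exp (b * a i j)) powr s) powr c = exp (b * (c * \<mu>)) * g b"
    using T_pos[of b] by (simp add: g powr_mult exp_powr_real mult.assoc mult.commute[of \<mu>])
  define n where "n = real (card J) powr \<bar>s\<bar>"
  have n1: "real (card J) \<ge> 1"
    using J by (simp add: Suc_leI card_gt_0_iff)
  have c1: "real (card I) \<ge> 1"
    using I by (simp add: Suc_leI card_gt_0_iff)
  have n: "n \<ge> 1"
    using n1 by (simp add: n_def ge_one_powr_ge_zero)
  have Zs: "1 / n \<le> Z i b powr s" "Z i b powr s \<le> n" if "b \<ge> 0" for i b
  proof -
    have "1 / real (card J) \<le> Z i b"
      using n1 Z_ge[of i b] by (intro order_trans[OF _ Z_ge]) simp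
    then show "1 / n \<le> Z i b powr s" "Z i b powr s \<le> n"
      unfolding n_def using n1 Z_le[OF that, of i] by (simp_all add: powr_between)
  qed
  have T: "1 / (card I * n) \<le> T b" "T b \<le> card I * n" if b: "b \<ge> 0" for b
  proof -
    have "1 / (card I * n) \<le> 1 / n"
      using n c1 by (intro divide_left_mono) auto
    also have "\<dots> \<le> exp (b * (s * m im - \<mu>)) * Z im b powr s"
      using Zs[OF b] im by simp
    also have "\<dots> \<le> T b"
      unfolding T_def using I im by (intro member_le_sum) auto
    finally show "1 / (card I * n) \<le> T b" .
    have "exp (b * (s * m i - \<mu>)) * Z i b powr s \<le> 1 * n" if "i \<in> I" for i
      using Zs[OF b] \<mu>[OF that] b by (intro mult_mono) (auto simp: mult_nonneg_nonpos)
    then show "T b \<le> card I * n"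
      unfolding T_def by (intro sum_bounded_above) auto
  qed
  have "card I * n > 0"
    using c1 n by simp
  then show "b \<ge> 0 \<Longrightarrow> 1 / B \<le> g b" and "b \<ge> 0 \<Longrightarrow> g b \<le> B"
    using powr_between[OF _ T] by (simp_all add: B_def g flip: n_def)
  show "\<exists>L. (g \<longlongrightarrow> L) at_top"
  proof -
    \<comment> \<open>In the limit only maximisers survive, and \<open>N i\<close> counts those of
      the inner maximum. It is at least 1, so real powers are continuous there.\<close>
    define N where "N = (\<lambda>i. \<Sum>j\<in>J. if a i j - m i = 0 then 1 else 0 :: real)"
    have "(Z i \<longlongrightarrow> N i) at_top" for i
      unfolding Z_def N_def using m by (intro tendsto_sum tendsto_exp_mult_nonpos) simp
    moreover have "N i > 0" for i
      unfolding N_def using J jm[of i] by (intro sum_pos2[of _ "jm i"]) auto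
    ultimately have "((\<lambda>b. Z i b powr s) \<longlongrightarrow> N i powr s) at_top" for i
      by (intro tendsto_powr tendsto_const) (auto simp: less_imp_neq[THEN not_sym])
    then have lim: "(T \<longlongrightarrow> (\<Sum>i\<in>I. (if s * m i - \<mu> = 0 then 1 else 0) * N i powr s)) at_top"
      unfolding T_def using \<mu> by (intro tendsto_sum tendsto_mult tendsto_exp_mult_nonpos) simp
    have "(\<Sum>i\<in>I. (if s * m i - \<mu> = 0 then 1 else 0) * N i powr s) > 0"
    proof (rule sum_pos2[OF I(1) im(1)])
      show "0 < (if s * m im - \<mu> = 0 then 1 else 0) * N im powr s"
        using im \<open>\<And>i. N i > 0\<close>[of im] by simp
    qed auto
    then have "((\<lambda>b. T b powr c) \<longlongrightarrow> (\<Sum>i\<in>I. (if s * m i - \<mu> = 0 then 1 else 0) * N i powr s) powr c) at_top"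
      by (intro tendsto_powr lim tendsto_const) auto
    then show ?thesis
      unfolding g by blast
  qed
qed

text \<open>If the rate \<open>X\<close> is almost surely nonpositive, then \<open>F\<close> stays
  below \<open>B\<close> and converges pointwise, and dominated convergence yields a finite limit.
  Otherwise the positive part of \<open>X\<close> has positive expectation and the integrals grow at
  least linearly in \<open>b\<close>, so the limit is infinite.\<close>

lemma (in prob_space) tendsto_integral_exp_mult:
  fixes F g :: "real \<Rightarrow> 'a \<Rightarrow> real" and X :: "'a \<Rightarrow> real" and B :: real
  assumes F: "\<And>b \<omega>. F b \<omega> = exp (b * X \<omega>) * g b \<omega>"
    and B: "B > 0" and g: "\<And>b \<omega>. b \<ge> 0 \<Longrightarrow> 1 / B \<le> g b \<omega>" "\<And>b \<omega>. b \<ge> 0 \<Longrightarrow> g b \<omega> \<le> B"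
    and lim: "\<And>\<omega>. \<exists>L. ((\<lambda>b. g b \<omega>) \<longlongrightarrow> L) at_top"
    and X [measurable]: "X \<in> borel_measurable M"
    and int: "\<And>b. integrable M (F b)"
  shows "\<exists>L. ((\<lambda>b. ereal (\<integral>\<omega>. F b \<omega> \<partial>M)) \<longlongrightarrow> L) at_top"
proof (cases "AE \<omega> in M. X \<omega> \<le> 0")
  case True
  have [measurable]: "F b \<in> borel_measurable M" for b
    using int by (rule borel_measurable_integrable)
  \<comment> \<open>Taking the limit along the natural numbers makes \<open>G\<close> measurable;
    almost everywhere it agrees with the limit along the reals.\<close>
  define G where "G = (\<lambda>\<omega>. lim (\<lambda>n. F (real n) \<omega>))"
  have "((\<lambda>b. integral\<^sup>L M (F b)) \<longlongrightarrow> integral\<^sup>L M G) at_top"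
  proof (rule integral_dominated_convergence_at_top)
    show "G \<in> borel_measurable M"
      unfolding G_def by measurable
    show "integrable M (\<lambda>_. B)"
      by simp
    show "AE \<omega> in M. ((\<lambda>b. F b \<omega>) \<longlongrightarrow> G \<omega>) at_top"
      using True
    proof eventually_elim
      case (elim \<omega>)
      obtain L where "((\<lambda>b. g b \<omega>) \<longlongrightarrow> L) at_top"
        using lim by blast
      from tendsto_mult[OF tendsto_exp_mult_nonpos[OF elim] this]
      obtain L' where L': "((\<lambda>b. F b \<omega>) \<longlongrightarrow> L') at_top"
        by (auto simp: F)
      then have "(\<lambda>n. F (real n) \<omega>) \<longlonglongrightarrow> L'"
        by (rule filterlim_compose) (rule filterlim_real_sequentially)
      then have "G \<omega> = L'"
        unfolding G_def by (rule limI)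
      with L' show ?case by simp
    qed
    show "\<forall>\<^sub>F b in at_top. AE \<omega> in M. norm (F b \<omega>) \<le> B"
      using eventually_ge_at_top[of 0]
    proof eventually_elim
      case b: (elim b)
      show ?case
        using True
      proof eventually_elim
        case (elim \<omega>)
        have "g b \<omega> \<ge> 0"
          using g(1)[OF b, of \<omega>] B by (meson divide_nonneg_pos order_trans zero_le_one)
        moreover have "exp (b * X \<omega>) \<le> 1"
          using b elim by (simp add: mult_nonneg_nonpos)
        ultimately have "exp (b * X \<omega>) * g b \<omega> \<le> 1 * B"
          using g(2)[OF b, of \<omega>] by (intro mult_mono) auto
        then show ?case
          using \<open>g b \<omega> \<ge> 0\<close> by (simp add: F)
      qed
    qed
  qed measurable
  then show ?thesis
    by (intro exI) (rule tendsto_ereal)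
next
  case False
  define Y where "Y = (\<lambda>\<omega>. max (X \<omega>) 0)"
  have [measurable]: "Y \<in> borel_measurable M"
    unfolding Y_def by measurable
  \<comment> \<open>The inequality \<open>1 + z \<le> exp z\<close> bounds the exponential below by
    a linear function of \<open>b\<close>.\<close>
  have F_ge: "1 / B * (b * Y \<omega>) \<le> F b \<omega>" if b: "b \<ge> 0" for b \<omega>
  proof -
    have "b * Y \<omega> \<le> exp (b * X \<omega>)"
    proof (cases "X \<omega> \<le> 0")
      case False
      then have "Y \<omega> = X \<omega>"
        by (simp add: Y_def)
      moreover have "b * X \<omega> \<le> exp (b * X \<omega>)"
        using exp_ge_add_one_self[of "b * X \<omega>"] by linarith
      ultimately show ?thesis
        by (simp only:)
    qed (simp add: Y_def)
    then have "(b * Y \<omega>) * (1 / B) \<le> exp (b * X \<omega>) * g b \<omega>"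
      using g(1)[OF b, of \<omega>] B b by (intro mult_mono) (auto simp: Y_def)
    then show ?thesis
      by (simp add: F mult.commute)
  qed
  \<comment> \<open>The linear lower bound at \<open>b = 1\<close> dominates \<open>Y\<close> by the
    integrable function \<open>B * F 1\<close>.\<close>
  have intY: "integrable M Y"
  proof (rule Bochner_Integration.integrable_bound)
    show "integrable M (\<lambda>\<omega>. B * F 1 \<omega>)"
      using int by simp
    show "AE \<omega> in M. norm (Y \<omega>) \<le> norm (B * F 1 \<omega>)"
    proof (rule AE_I2)
      fix \<omega>
      have "Y \<omega> \<le> B * F 1 \<omega>" "Y \<omega> \<ge> 0"
        using F_ge[of 1 \<omega>] B by (auto simp: field_simps Y_def)
      then show "norm (Y \<omega>) \<le> norm (B * F 1 \<omega>)"
        by simp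
    qed
  qed measurable
  have "integral\<^sup>L M Y \<noteq> 0"
  proof
    assume "integral\<^sup>L M Y = 0"
    then have "AE \<omega> in M. Y \<omega> = 0"
      using integral_nonneg_eq_0_iff_AE[OF intY] by (simp add: Y_def)
    then have "AE \<omega> in M. X \<omega> \<le> 0"
      by eventually_elim (simp add: Y_def max_def split: if_splits)
    with False show False ..
  qed
  moreover have "integral\<^sup>L M Y \<ge> 0"
    by (intro Bochner_Integration.integral_nonneg) (simp add: Y_def)
  ultimately have Y: "integral\<^sup>L M Y > 0"
    by simp
  have "1 / B * integral\<^sup>L M Y * b \<le> integral\<^sup>L M (F b)" if "b \<ge> 0" for b
  proof -
    have "(\<integral>\<omega>. 1 / B * (b * Y \<omega>) \<partial>M) \<le> integral\<^sup>L M (F b)"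
      using F_ge[OF that] by (intro integral_mono int integrable_mult_right intY) auto
    then show ?thesis by (simp add: mult.commute)
  qed
  moreover have "filterlim (\<lambda>b. 1 / B * integral\<^sup>L M Y * b) at_top at_top"
    using Y B by (intro filterlim_tendsto_pos_mult_at_top[OF tendsto_const]) (auto simp: filterlim_ident)
  ultimately have "filterlim (\<lambda>b. integral\<^sup>L M (F b)) at_top at_top"
    by (elim filterlim_at_top_mono) (auto simp: eventually_at_top_linorder)
  then show ?thesis
    by (auto simp flip: tendsto_PInfty_eq_at_top)
qed

text \<open>The random growth rate is \<open>c\<close> times the nested maximum over
  \<open>I\<close> and \<open>J\<close>. The constant bounding the remaining factor depends only on
  the cardinalities and the exponents, not on \<open>w\<close>, as the dichotomy requires.\<close>

lemma nested_exp_sum_integral_converges: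
  fixes v :: "'i \<Rightarrow> 'j \<Rightarrow> 'k::finite \<Rightarrow> real" and s c t :: real
  assumes I: "finite I" "I \<noteq> {}" and J: "finite J" "J \<noteq> {}" and t: "t \<in> {0..1}"
  shows "\<exists>L. ((\<lambda>b. ereal (\<integral>w. exp_sum_functional.\<Phi> I J v b s c (\<lambda>k. interp_coeff A t k * w k)
    \<partial>std_normal_family)) \<longlongrightarrow> L) at_top"
proof -
  interpret exp_sum_functional I J v b s c for b
    using assms by unfold_locales
  interpret P: prob_space "std_normal_family :: ('k \<Rightarrow> real) measure"
    by (rule prob_space_std_normal_family)
  define a where "a = (\<lambda>w i j. \<Sum>k\<in>UNIV. v i j k * (interp_coeff A t k * w k))"
  have [measurable]: "(\<lambda>w. a w i j) \<in> borel_measurable (PiM UNIV (\<lambda>_. borel))" for i j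
    unfolding a_def by measurable
  have \<Phi>_eq: "\<Phi> b (\<lambda>k. interp_coeff A t k * w k) = (\<Sum>i\<in>I. (\<Sum>j\<in>J. exp (b * a w i j)) powr s) powr c" for b w
    by (simp add: \<Phi>_def S_def Z_def e_def a_def)
  have B: "(card I * card J powr \<bar>s\<bar>) powr \<bar>c\<bar> > 0"
    using I J by (simp add: card_gt_0_iff)
  note asym = nested_exp_sum_asymptotics[OF I J]
  have int: "integrable std_normal_family (\<lambda>w. \<Phi> b (\<lambda>k. interp_coeff A t k * w k))" for b
    by (rule integrable_std_normal_family[OF exp_bounded_scale[OF exp_bounded_\<Phi> interp_coeff_le[OF t]]])
      measurable
  have meas: "(\<lambda>w. c * Max ((\<lambda>i. s * Max ((\<lambda>j. a w i j) ` J)) ` I))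
      \<in> borel_measurable (PiM UNIV (\<lambda>_. borel))"
  proof -
    have [measurable]: "(\<lambda>w. Max ((\<lambda>j. a w i j) ` J)) \<in> borel_measurable (PiM UNIV (\<lambda>_. borel))" for i
      by (rule borel_measurable_Max[OF J(1)]) measurable
    have "(\<lambda>w. Max ((\<lambda>i. s * Max ((\<lambda>j. a w i j) ` J)) ` I)) \<in> borel_measurable (PiM UNIV (\<lambda>_. borel))"
      by (rule borel_measurable_Max[OF I(1)]) measurable
    then show ?thesis
      by (rule borel_measurable_times[OF borel_measurable_const])
  qed
  show ?thesis
  proof (rule P.tendsto_integral_exp_mult[OF _ B asym(2,3,4) _ int])
    show "\<Phi> b (\<lambda>k. interp_coeff A t k * w k) = exp (b * (c * Max ((\<lambda>i. s * Max (a w i ` J)) ` I))) *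
      (\<Sum>i\<in>I. exp (b * (s * Max (a w i ` J) - Max ((\<lambda>i. s * Max (a w i ` J)) ` I))) *
        (\<Sum>j\<in>J. exp (b * (a w i j - Max (a w i ` J)))) powr s) powr c" for b w
      unfolding \<Phi>_eq by (rule asym(1))
    show "(\<lambda>w. c * Max ((\<lambda>i. s * Max (a w i ` J)) ` I)) \<in> borel_measurable std_normal_family"
      unfolding borel_measurable_std_normal_family by (rule meas)
  qed auto
qed

subsection \<open>The comparison principle\<close>

lemma mono_on_has_real_derivative:
  fixes f :: "real \<Rightarrow> real"
  assumes "\<And>t. t \<in> {a..b} \<Longrightarrow> \<exists>D. (f has_real_derivative D) (at t within {a..b}) \<and> D \<ge> 0"
  shows "mono_on {a..b} f"
proof (rule mono_onI)
  fix r u assume ru: "r \<in> {a..b}" "u \<in> {a..b}" "r \<le> u"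
  show "f r \<le> f u"
  proof (rule DERIV_nonneg_imp_increasing_open[OF ru(3)])
    show "\<exists>D. (f has_real_derivative D) (at t) \<and> D \<ge> 0" if "r < t" "t < u" for t
      using assms[of t] that ru by (auto simp: at_within_Icc_at)
    have "continuous_on {a..b} f"
      unfolding continuous_on_eq_continuous_within using assms by (meson DERIV_continuous)
    then show "continuous_on {r..u} f"
      by (rule continuous_on_subset) (use ru in auto)
  qed
qed

lemma strict_mono_on_has_real_derivative:
  fixes f :: "real \<Rightarrow> real"
  assumes "\<And>t. t \<in> {a..b} \<Longrightarrow> \<exists>D. (f has_real_derivative D) (at t within {a..b}) \<and> D > 0"
  shows "strict_mono_on {a..b} f"
proof (rule strict_mono_onI)
  fix r u assume ru: "r \<in> {a..b}" "u \<in> {a..b}" "r < u"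
  show "f r < f u"
  proof (rule DERIV_pos_imp_increasing_open[OF ru(3)])
    show "\<exists>D. (f has_real_derivative D) (at t) \<and> D > 0" if "r < t" "t < u" for t
      using assms[of t] that ru by (auto simp: at_within_Icc_at)
    have "continuous_on {a..b} f"
      unfolding continuous_on_eq_continuous_within using assms by (meson DERIV_continuous)
    then show "continuous_on {r..u} f"
      by (rule continuous_on_subset) (use ru in auto)
  qed
qed

section \<open>The process as a linear form in independent coordinates\<close>

type_synonym ('m, 'n) gaussian_index = "('m \<times> 'n) + unit + 'm + 'n"

text \<open>These are the coefficients of the components of \<open>G\<close>, \<open>u4\<close>,
  \<open>u2\<close> and \<open>h\<close>, in this order, with the dependence on \<open>t\<close>
  left to \<open>interp_coeff\<close>.\<close>

definition interp_direction ::
  "(nat \<Rightarrow> real^'n) \<Rightarrow> (nat \<Rightarrow> real^'m) \<Rightarrow> nat \<Rightarrow> nat \<Rightarrow> ('m, 'n) gaussian_index \<Rightarrow> real" where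
  "interp_direction x y i j k =
     (case k of
        Inl (a, b) \<Rightarrow> y j $ a * x i $ b
      | Inr (Inl _) \<Rightarrow> norm (x i) * norm (y j)
      | Inr (Inr (Inl a)) \<Rightarrow> norm (x i) * y j $ a
      | Inr (Inr (Inr b)) \<Rightarrow> norm (y j) * x i $ b)"

definition sqrt_t_part :: "('m, 'n) gaussian_index set" where
  "sqrt_t_part = range Inl \<union> {Inr (Inl ())}"

lemma sum_gaussian_index:
  fixes f :: "('m::finite, 'n::finite) gaussian_index \<Rightarrow> real"
  shows "(\<Sum>k\<in>UNIV. f k) = (\<Sum>a\<in>UNIV. \<Sum>b\<in>UNIV. f (Inl (a, b))) + f (Inr (Inl ()))
    + (\<Sum>a\<in>UNIV. f (Inr (Inr (Inl a)))) + (\<Sum>b\<in>UNIV. f (Inr (Inr (Inr b))))"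
  unfolding UNIV_Plus_UNIV[symmetric] UNIV_Times_UNIV[symmetric]
  by (simp add: sum.Plus UNIV_unit sum.cartesian_product del: UNIV_Plus_UNIV UNIV_Times_UNIV)

lemma H_interp_eq_sum:
  "H_interp (G \<omega>) (u4 \<omega>) (u2 \<omega>) (h \<omega>) t (x i) (y j)
    = (\<Sum>k\<in>UNIV. interp_direction x y i j k *
        (interp_coeff sqrt_t_part t k * gaussian_components G u4 u2 h k \<omega>))"
  unfolding sum_gaussian_index H_interp_def
  by (auto simp: interp_direction_def interp_coeff_def sqrt_t_part_def gaussian_components_def
      inner_vec_def matrix_vector_mult_def sum_distrib_left image_iff ac_simps)

text \<open>The blocks of \<open>G\<close> and \<open>u4\<close> contribute the product of the two
  inner products and the product of all four norms; the blocks of \<open>u2\<close> and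
  \<open>h\<close> subtract the two mixed products. The \<open>u4\<close> block is what completes
  the factorisation.\<close>

lemma interp_direction_covariance:
  "(\<Sum>k\<in>UNIV. (if k \<in> sqrt_t_part then 1 else - 1) * interp_direction x y i j k * interp_direction x y i' j' k)
    = (norm (x i) * norm (x i') - x i \<bullet> x i') * (norm (y j) * norm (y j') - y j \<bullet> y j')"
proof -
  have "(\<Sum>a\<in>UNIV. \<Sum>b\<in>UNIV. y j $ a * x i $ b * (y j' $ a * x i' $ b)) = (y j \<bullet> y j') * (x i \<bullet> x i')"
    by (simp add: inner_vec_def sum_product ac_simps)
  moreover have "(\<Sum>a\<in>UNIV. norm (x i) * y j $ a * (norm (x i') * y j' $ a)) = norm (x i) * norm (x i') * (y j \<bullet> y j')"
    by (simp add: inner_vec_def sum_distrib_left ac_simps)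
  moreover have "(\<Sum>b\<in>UNIV. norm (y j) * x i $ b * (norm (y j') * x i' $ b)) = norm (y j) * norm (y j') * (x i \<bullet> x i')"
    by (simp add: inner_vec_def sum_distrib_left ac_simps)
  ultimately show ?thesis
    unfolding sum_gaussian_index
    by (simp add: interp_direction_def sqrt_t_part_def sum_negf image_iff) (simp add: algebra_simps)
qed

text \<open>Independence of the components with standard normal marginals says that their joint law
  is the product measure. Expectations over \<open>M\<close> can therefore be computed on the
  product space, where integration by parts is available.\<close>

lemma distr_gaussian_components:
  assumes "iid_std_normal M G u4 u2 h"
  shows "distr M (PiM UNIV (\<lambda>_. borel)) (\<lambda>\<omega> k. gaussian_components G u4 u2 h k \<omega>) = std_normal_family"
    and "(\<lambda>\<omega> k. gaussian_components G u4 u2 h k \<omega>) \<in> M \<rightarrow>\<^sub>M PiM UNIV (\<lambda>_. borel)"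
proof -
  interpret prob_space M
    using assms by (simp add: iid_std_normal_def)
  let ?g = "gaussian_components G u4 u2 h"
  have d: "distributed M lborel (?g k) std_normal_density" for k
    using assms by (simp add: iid_std_normal_def)
  have meas: "?g k \<in> borel_measurable M" for k
    using distributed_measurable[OF d] by simp
  \<comment> \<open>Densities refer to \<open>lborel\<close> and independence to
    \<open>borel\<close>; the two have the same measurable sets.\<close>
  have "distr M borel (?g k) = std_normal" for k
    using distributed_distr_eq_density[OF d, of k] by (metis distr_cong sets_lborel)
  moreover have "indep_vars (\<lambda>_. borel) ?g UNIV"
    using assms by (simp add: iid_std_normal_def)
  ultimately show "distr M (PiM UNIV (\<lambda>_. borel)) (\<lambda>\<omega> k. ?g k \<omega>) = std_normal_family"
    using indep_vars_iff_distr_eq_PiM'[where I = UNIV and M' = "\<lambda>_. borel" and X = ?g] meas by (simp add: restrict_def)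
  show "(\<lambda>\<omega> k. ?g k \<omega>) \<in> M \<rightarrow>\<^sub>M PiM UNIV (\<lambda>_. borel)"
    using meas by (intro measurable_PiM_single') (auto simp: space_PiM)
qed

lemma psi_star_eq_integral:
  fixes x :: "nat \<Rightarrow> real^'n" and y :: "nat \<Rightarrow> real^'m"
  assumes iid: "iid_std_normal M G u4 u2 h" and l: "l \<ge> 1"
  shows "psi_star M G u4 u2 h l x y \<beta> s c t
    = (\<integral>w. exp_sum_functional.\<Phi> {1..l} {1..l} (interp_direction x y) \<beta> s c
        (\<lambda>k. interp_coeff sqrt_t_part t k * w k) \<partial>std_normal_family)"
proof -
  interpret exp_sum_functional "{1..l}" "{1..l}" "interp_direction x y" \<beta> s c
    using l by unfold_locales auto
  have "psi_star M G u4 u2 h l x y \<beta> s c t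
      = (\<integral>\<omega>. \<Phi> (\<lambda>k. interp_coeff sqrt_t_part t k * gaussian_components G u4 u2 h k \<omega>) \<partial>M)"
    unfolding psi_star_def \<Phi>_def S_def Z_def e_def H_interp_eq_sum ..
  also have "\<dots> = (\<integral>w. \<Phi> (\<lambda>k. interp_coeff sqrt_t_part t k * w k) \<partial>std_normal_family)"
    unfolding distr_gaussian_components(1)[OF iid, symmetric]
    by (rule integral_distr[symmetric, OF distr_gaussian_components(2)[OF iid]]) measurable
  finally show ?thesis .
qed

text \<open>Cauchy-Schwarz in each family makes both factors of the covariance difference
  nonnegative, and the first one is zero when the two first vectors coincide.\<close>

lemma psi_star_has_real_derivative:
  fixes x :: "nat \<Rightarrow> real^'n" and y :: "nat \<Rightarrow> real^'m"
  assumes iid: "iid_std_normal M G u4 u2 h" and l: "l \<ge> 1" and \<beta>: "\<beta> > 0" and t: "t \<in> {0..1}"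
  obtains D where
    "(psi_star M G u4 u2 h l x y \<beta> s c has_real_derivative c * (c - 1) * D) (at t within {0..1})"
    "D \<ge> 0" "nondegenerate l x y s \<Longrightarrow> D > 0"
proof -
  interpret exp_sum_functional "{1..l}" "{1..l}" "interp_direction x y" \<beta> s c
    using l by unfold_locales auto
  obtain D where D:
    "((\<lambda>t. \<integral>w. \<Phi> (\<lambda>k. interp_coeff sqrt_t_part t k * w k) \<partial>std_normal_family)
      has_real_derivative c * (c - 1) * D) (at t within {0..1})" "D \<ge> 0"
    "\<exists>i\<in>{1..l}. \<exists>i'\<in>{1..l}. \<exists>j\<in>{1..l}. \<exists>j'\<in>{1..l}.
      0 < (norm (x i) * norm (x i') - x i \<bullet> x i') * (norm (y j) * norm (y j') - y j \<bullet> y j') \<Longrightarrow>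
      s \<noteq> 0 \<Longrightarrow> \<beta> \<noteq> 0 \<Longrightarrow> D > 0"
  proof (rule has_real_derivative_integral_\<Phi>_signed[OF t, of sqrt_t_part])
    show "0 \<le> (\<Sum>k\<in>UNIV. (if k \<in> sqrt_t_part then 1 else - 1) *
        interp_direction x y i j k * interp_direction x y i' j' k)" for i i' j j'
      unfolding interp_direction_covariance by (simp add: norm_cauchy_schwarz)
    show "(\<Sum>k\<in>UNIV. (if k \<in> sqrt_t_part then 1 else - 1) *
        interp_direction x y i j k * interp_direction x y i j' k) = 0" for i j j'
      unfolding interp_direction_covariance by (simp add: norm_eq_sqrt_inner)
  qed (unfold interp_direction_covariance, blast)
  show ?thesis
  proof (rule that[of D])
    show "(psi_star M G u4 u2 h l x y \<beta> s c has_real_derivative c * (c - 1) * D) (at t within {0..1})"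
      using D(1) unfolding psi_star_eq_integral[OF iid l, abs_def] .
    show "D > 0" if nd: "nondegenerate l x y s"
    proof -
      obtain i i' j j' where *: "i \<in> {1..l}" "i' \<in> {1..l}" "j \<in> {1..l}" "j' \<in> {1..l}"
        and "x i \<bullet> x i' \<noteq> norm (x i) * norm (x i')" "y j \<bullet> y j' \<noteq> norm (y j) * norm (y j')"
        using nd unfolding nondegenerate_def by blast
      \<comment> \<open>The strict Cauchy-Schwarz pairs of the two families may be chosen
        independently, because every \<open>x i\<close> is paired with every \<open>y j\<close> in
        the sums.\<close>
      then have "0 < (norm (x i) * norm (x i') - x i \<bullet> x i') * (norm (y j) * norm (y j') - y j \<bullet> y j')"
        using norm_cauchy_schwarz[of "x i" "x i'"] norm_cauchy_schwarz[of "y j" "y j'"]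
        by (intro mult_pos_pos) linarith+
      with * have "\<exists>i\<in>{1..l}. \<exists>i'\<in>{1..l}. \<exists>j\<in>{1..l}. \<exists>j'\<in>{1..l}.
          0 < (norm (x i) * norm (x i') - x i \<bullet> x i') * (norm (y j) * norm (y j') - y j \<bullet> y j')"
        by blast
      then show ?thesis
        by (rule D(3)) (use nd \<beta> in \<open>auto simp: nondegenerate_def\<close>)
    qed
  qed (rule D(2))
qed

lemma psi_star_converges:
  assumes "iid_std_normal M G u4 u2 h" "l \<ge> 1" "t \<in> {0..1}"
  shows "\<exists>L. ((\<lambda>b. ereal (psi_star M G u4 u2 h l x y b s c t)) \<longlongrightarrow> L) at_top"
  unfolding psi_star_eq_integral[OF assms(1,2)]
  using assms by (intro nested_exp_sum_integral_converges) auto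

text \<open>The sign of \<open>c3 * (c3 - 1)\<close> separates the two cases. The comparison of
  limits uses monotonicity in \<open>t\<close> at every positive inverse temperature
  \<open>b\<close>, not just at the given \<open>\<beta>\<close>, and non-strict inequalities pass
  to limits in \<open>ereal\<close>.\<close>

theorem corollary2:
  fixes M :: "'a measure"
    and G :: "'a \<Rightarrow> real^'n^'m" and u4 :: "'a \<Rightarrow> real"
    and u2 :: "'a \<Rightarrow> real^'m" and h :: "'a \<Rightarrow> real^'n"
    and l :: nat and x :: "nat \<Rightarrow> real^'n" and y :: "nat \<Rightarrow> real^'m"
    and \<beta> s c3 :: real
  assumes "iid_std_normal M G u4 u2 h"
    and "l \<ge> 1"
    and "\<beta> > 0"
  defines "\<psi> \<equiv> psi_star M G u4 u2 h l x y"
  shows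
    "(0 < c3 \<and> c3 < 1 \<longrightarrow>
        (\<forall>t\<in>{0..1}. \<exists>D. (\<psi> \<beta> s c3 has_real_derivative D) (at t within {0..1}) \<and>
            D \<le> 0 \<and> (nondegenerate l x y s \<longrightarrow> D < 0)) \<and>
        antimono_on {0..1} (\<psi> \<beta> s c3) \<and>
        (nondegenerate l x y s \<longrightarrow> strict_antimono_on {0..1} (\<psi> \<beta> s c3)) \<and>
        (\<exists>L :: real \<Rightarrow> ereal. \<forall>t\<in>{0..1}.
            ((\<lambda>b. ereal (\<psi> b s c3 t)) \<longlongrightarrow> L t) at_top \<and> L 0 \<ge> L t \<and> L t \<ge> L 1))
     \<and>
     (c3 > 1 \<or> c3 < 0 \<longrightarrow>
        (\<forall>t\<in>{0..1}. \<exists>D. (\<psi> \<beta> s c3 has_real_derivative D) (at t within {0..1}) \<and>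
            D \<ge> 0 \<and> (nondegenerate l x y s \<longrightarrow> D > 0)) \<and>
        mono_on {0..1} (\<psi> \<beta> s c3) \<and>
        (nondegenerate l x y s \<longrightarrow> strict_mono_on {0..1} (\<psi> \<beta> s c3)) \<and>
        (\<exists>L :: real \<Rightarrow> ereal. \<forall>t\<in>{0..1}.
            ((\<lambda>b. ereal (\<psi> b s c3 t)) \<longlongrightarrow> L t) at_top \<and> L 0 \<le> L t \<and> L t \<le> L 1))"
proof -
  have deriv: "\<exists>D. (\<psi> b s c3 has_real_derivative c3 * (c3 - 1) * D) (at t within {0..1}) \<and> D \<ge> 0 \<and>
      (nondegenerate l x y s \<longrightarrow> D > 0)" if "b > 0" "t \<in> {0..1}" for b t
    using psi_star_has_real_derivative[OF assms(1,2) that, of x y s c3] unfolding \<psi>_def by metis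
  have "\<forall>t\<in>{0..1}. \<exists>L. ((\<lambda>b. ereal (\<psi> b s c3 t)) \<longlongrightarrow> L) at_top"
    unfolding \<psi>_def using psi_star_converges[OF assms(1,2)] by blast
  from bchoice[OF this] obtain L where
    L: "\<And>t. t \<in> {0..1} \<Longrightarrow> ((\<lambda>b. ereal (\<psi> b s c3 t)) \<longlongrightarrow> L t) at_top"
    by blast
  \<comment> \<open>Only positive \<open>b\<close> are available, which suffices because the limit
    is at infinity.\<close>
  have L_le: "L t \<le> L u"
    if "\<And>b. b > 0 \<Longrightarrow> \<psi> b s c3 t \<le> \<psi> b s c3 u" "t \<in> {0..1}" "u \<in> {0..1}" for t u
    using tendsto_le[OF trivial_limit_at_top_linorder L[OF that(3)] L[OF that(2)]]
      eventually_gt_at_top[of "0::real"] that(1)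
    by (simp add: eventually_mono)
  show ?thesis
  proof (intro conjI impI)
    assume "0 < c3 \<and> c3 < 1"
    then have sgn: "c3 * (c3 - 1) < 0"
      by (simp add: mult_pos_neg)
    have deriv': "\<exists>D. (\<psi> b s c3 has_real_derivative D) (at t within {0..1}) \<and>
        D \<le> 0 \<and> (nondegenerate l x y s \<longrightarrow> D < 0)" if "b > 0" "t \<in> {0..1}" for b t
      using deriv[OF that] sgn by (meson less_imp_le mult_neg_pos mult_nonpos_nonneg)
    then show "\<forall>t\<in>{0..1}. \<exists>D. (\<psi> \<beta> s c3 has_real_derivative D) (at t within {0..1}) \<and>
        D \<le> 0 \<and> (nondegenerate l x y s \<longrightarrow> D < 0)"
      using \<open>\<beta> > 0\<close> by blast
    have anti: "antimono_on {0..1} (\<psi> b s c3)" if "b > 0" for b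
    proof -
      \<comment> \<open>The decreasing case is reduced to the increasing one by negation.\<close>
      have "mono_on {0..1} (\<lambda>t. - \<psi> b s c3 t)"
      proof (rule mono_on_has_real_derivative)
        fix t :: real assume "t \<in> {0..1}"
        from deriv'[OF \<open>b > 0\<close> this] obtain D
          where D: "(\<psi> b s c3 has_real_derivative D) (at t within {0..1})" "D \<le> 0"
          by blast
        from DERIV_minus[OF D(1)] D(2)
        show "\<exists>D. ((\<lambda>t. - \<psi> b s c3 t) has_real_derivative D) (at t within {0..1}) \<and> D \<ge> 0"
          by (metis neg_0_le_iff_le)
      qed
      then show ?thesis
        by (simp add: monotone_on_def)
    qed
    show "antimono_on {0..1} (\<psi> \<beta> s c3)"
      using anti \<open>\<beta> > 0\<close> .
    show "strict_antimono_on {0..1} (\<psi> \<beta> s c3)" if nd: "nondegenerate l x y s"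
    proof -
      have "strict_mono_on {0..1} (\<lambda>t. - \<psi> \<beta> s c3 t)"
      proof (rule strict_mono_on_has_real_derivative)
        fix t :: real assume "t \<in> {0..1}"
        from deriv'[OF \<open>\<beta> > 0\<close> this] nd obtain D
          where D: "(\<psi> \<beta> s c3 has_real_derivative D) (at t within {0..1})" "D < 0"
          by blast
        from DERIV_minus[OF D(1)] D(2)
        show "\<exists>D. ((\<lambda>t. - \<psi> \<beta> s c3 t) has_real_derivative D) (at t within {0..1}) \<and> D > 0"
          by (metis neg_0_less_iff_less)
      qed
      then show ?thesis
        by (simp add: monotone_on_def)
    qed
    show "\<exists>L :: real \<Rightarrow> ereal. \<forall>t\<in>{0..1}.
        ((\<lambda>b. ereal (\<psi> b s c3 t)) \<longlongrightarrow> L t) at_top \<and> L 0 \<ge> L t \<and> L t \<ge> L 1"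
      using anti by (intro exI[of _ L] ballI conjI L L_le) (auto simp: monotone_on_def)
  next
    assume "c3 > 1 \<or> c3 < 0"
    then have sgn: "c3 * (c3 - 1) > 0"
      by (auto intro: mult_pos_pos mult_neg_neg)
    have deriv': "\<exists>D. (\<psi> b s c3 has_real_derivative D) (at t within {0..1}) \<and>
        D \<ge> 0 \<and> (nondegenerate l x y s \<longrightarrow> D > 0)" if "b > 0" "t \<in> {0..1}" for b t
      using deriv[OF that] sgn by (meson less_imp_le mult_pos_pos mult_nonneg_nonneg)
    then show "\<forall>t\<in>{0..1}. \<exists>D. (\<psi> \<beta> s c3 has_real_derivative D) (at t within {0..1}) \<and>
        D \<ge> 0 \<and> (nondegenerate l x y s \<longrightarrow> D > 0)"
      using \<open>\<beta> > 0\<close> by blast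
    have mono: "mono_on {0..1} (\<psi> b s c3)" if "b > 0" for b
      using deriv'[OF that] by (intro mono_on_has_real_derivative) blast
    show "mono_on {0..1} (\<psi> \<beta> s c3)"
      using mono \<open>\<beta> > 0\<close> .
    show "strict_mono_on {0..1} (\<psi> \<beta> s c3)" if "nondegenerate l x y s"
      using deriv'[OF \<open>\<beta> > 0\<close>] that by (intro strict_mono_on_has_real_derivative) blast
    show "\<exists>L :: real \<Rightarrow> ereal. \<forall>t\<in>{0..1}.
        ((\<lambda>b. ereal (\<psi> b s c3 t)) \<longlongrightarrow> L t) at_top \<and> L 0 \<le> L t \<and> L t \<le> L 1"
      using mono by (intro exI[of _ L] ballI conjI L L_le) (auto simp: monotone_on_def)
  qed
qed

end
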